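(* Let $X$ be a $d$-dimensional $\epsilon$-colorful expander, $d>1$. Then all of the high order random walks on $X$ (on every dimension $0 \le i < d$) are $\mu$-rapidly mixing for $$\mu = 1 - \frac{\epsilon^2}{2(d+1)^2}.$$
   Context: $X$ is a pure $d$-dimensional simplicial complex; $X(i)$ denotes its $i$-faces, and the degree $\deg(\sigma)$ of a face is the number of $d$-faces containing it. For an $i$-cochain (subset) $W \subseteq X(i)$, its norm is $\|W\| = \sum_{\sigma \in W}\deg(\sigma) / \sum_{\tau \in X(i)}\deg(\tau)$. The expanding faces of $W$ are $\psi(W) = \{\tau \in X(i+1) \mid \exists\, \sigma,\sigma' \subset \tau: \sigma \in W,\ \sigma' \in X(i)\setminus W\}$. $X$ is an $\epsilon$-colorful expander ($\epsilon>0$) if for every $0 \le i < d$ and every $W \subseteq X(i)$ with $0 < \|W\| \le 1/2$ we have $\|\psi(W)\|/\|W\| \ge \epsilon$. The high order random walk on dimension $i$ ($0 \le i < d$): two $i$-faces $\sigma,\sigma'$ are neighbors ($\sigma\sim\sigma'$) if $\sigma\cup\sigma' \in X(i+1)$; from $\sigma_t$ one moves to a neighbor $\sigma'$ with probability $\deg(\sigma_t\cup\sigma')/\sum_{\sigma''\sim\sigma_t}\deg(\sigma_t\cup\sigma'')$. Equivalently it is the random walk on the graph $G_i$ with vertex set $X(i)$ and $\deg(\sigma\cup\sigma')$ parallel edges between neighbors $\sigma\sim\sigma'$. For $i=0$ the walk is taken to be lazy: $\deg(v)$ self-loops are added at each vertex $v$ of $G_0$ (staying put with probability $1/2$). A random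 walk on a graph with stationary distribution $\pi$ is $\mu$-rapidly mixing ($0<\mu<1$) if for any initial distribution $\pi_0$ and any $t\in\mathbb N$, $\|\pi_t-\pi\|_2 \le \sqrt{d_{max}/d_{min}}\,\mu^t$, where $d_{max},d_{min}$ are the maximum and minimum vertex degrees of the graph. *)

theory Defs
  imports Complex_Main "HOL-Analysis.L2_Norm"
begin

subsection \<open>Pure simplicial complexes and colorful expansion\<close>

definition faces :: "'a set set \<Rightarrow> nat \<Rightarrow> 'a set set" where
  "faces X i = {\<sigma> \<in> X. card \<sigma> = i + 1}"

text \<open>The last condition both bounds the dimension by \<open>d\<close> and expresses purity;
  with \<open>X \<noteq> {}\<close> it makes the dimension exactly \<open>d\<close>.\<close>

definition pure_simplicial_complex :: "nat \<Rightarrow> 'a set set \<Rightarrow> bool" where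
  "pure_simplicial_complex d X \<longleftrightarrow>
     finite X \<and> X \<noteq> {} \<and>
     (\<forall>\<sigma>\<in>X. finite \<sigma>) \<and>
     (\<forall>\<sigma>\<in>X. \<forall>\<tau>. \<tau> \<subseteq> \<sigma> \<longrightarrow> \<tau> \<in> X) \<and>
     (\<forall>\<sigma>\<in>X. \<exists>\<tau>\<in>faces X d. \<sigma> \<subseteq> \<tau>)"

definition face_deg :: "nat \<Rightarrow> 'a set set \<Rightarrow> 'a set \<Rightarrow> nat" where
  "face_deg d X \<sigma> = card {\<tau> \<in> faces X d. \<sigma> \<subseteq> \<tau>}"

definition cochain_norm :: "nat \<Rightarrow> 'a set set \<Rightarrow> nat \<Rightarrow> 'a set set \<Rightarrow> real" where
  "cochain_norm d X i W =
     (\<Sum>\<sigma>\<in>W. real (face_deg d X \<sigma>)) / (\<Sum>\<tau>\<in>faces X i. real (face_deg d X \<tau>))"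

definition expanding_faces :: "'a set set \<Rightarrow> nat \<Rightarrow> 'a set set \<Rightarrow> 'a set set" where
  "expanding_faces X i W =
     {\<tau> \<in> faces X (i + 1). \<exists>\<sigma> \<sigma>'. \<sigma> \<subset> \<tau> \<and> \<sigma>' \<subset> \<tau> \<and> \<sigma> \<in> W \<and> \<sigma>' \<in> faces X i - W}"

definition colorful_expander :: "nat \<Rightarrow> 'a set set \<Rightarrow> real \<Rightarrow> bool" where
  "colorful_expander d X \<epsilon> \<longleftrightarrow>
     \<epsilon> > 0 \<and>
     (\<forall>i<d. \<forall>W \<subseteq> faces X i.
        0 < cochain_norm d X i W \<and> cochain_norm d X i W \<le> 1/2 \<longrightarrow>
        cochain_norm d X (i + 1) (expanding_faces X i W) / cochain_norm d X i W \<ge> \<epsilon>)"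

subsection \<open>Random walks on finite multigraphs\<close>

text \<open>A multigraph is a vertex set \<open>V\<close> together with a symmetric function \<open>m\<close>, where \<open>m u v\<close> is
  the number of parallel edges between \<open>u\<close> and \<open>v\<close>, and \<open>m v v\<close> is the number of self-loops at
  \<open>v\<close>. A self-loop contributes one to the degree. Functions on \<open>V\<close> are total functions whose
  values outside \<open>V\<close> are never used.\<close>

definition graph_deg :: "'v set \<Rightarrow> ('v \<Rightarrow> 'v \<Rightarrow> nat) \<Rightarrow> 'v \<Rightarrow> nat" where
  "graph_deg V m v = (\<Sum>u\<in>V. m v u)"

definition walk_prob :: "'v set \<Rightarrow> ('v \<Rightarrow> 'v \<Rightarrow> nat) \<Rightarrow> 'v \<Rightarrow> 'v \<Rightarrow> real" where
  "walk_prob V m u v = real (m u v) / real (graph_deg V m u)"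

definition distribution_on :: "'v set \<Rightarrow> ('v \<Rightarrow> real) \<Rightarrow> bool" where
  "distribution_on V p \<longleftrightarrow> (\<forall>v\<in>V. 0 \<le> p v) \<and> (\<Sum>v\<in>V. p v) = 1"

definition walk_step :: "'v set \<Rightarrow> ('v \<Rightarrow> 'v \<Rightarrow> nat) \<Rightarrow> ('v \<Rightarrow> real) \<Rightarrow> 'v \<Rightarrow> real" where
  "walk_step V m p v = (\<Sum>u\<in>V. p u * walk_prob V m u v)"

definition stationary_distribution :: "'v set \<Rightarrow> ('v \<Rightarrow> 'v \<Rightarrow> nat) \<Rightarrow> ('v \<Rightarrow> real) \<Rightarrow> bool" where
  "stationary_distribution V m p \<longleftrightarrow>
     distribution_on V p \<and> (\<forall>v\<in>V. walk_step V m p v = p v)"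

text \<open>The existential quantifier over the stationary distribution is harmless: the bound below
  forces \<open>\<pi>\<close> to be the only stationary distribution, as \<open>\<mu> < 1\<close>.\<close>

definition rapidly_mixing :: "'v set \<Rightarrow> ('v \<Rightarrow> 'v \<Rightarrow> nat) \<Rightarrow> real \<Rightarrow> bool" where
  "rapidly_mixing V m \<mu> \<longleftrightarrow>
     0 < \<mu> \<and> \<mu> < 1 \<and>
     (\<exists>\<pi>. stationary_distribution V m \<pi> \<and>
       (\<forall>\<pi>\<^sub>0 t. distribution_on V \<pi>\<^sub>0 \<longrightarrow>
          L2_set (\<lambda>v. (walk_step V m ^^ t) \<pi>\<^sub>0 v - \<pi> v) V
            \<le> sqrt (real (Max (graph_deg V m ` V)) / real (Min (graph_deg V m ` V))) * \<mu> ^ t))"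

subsection \<open>High order random walks\<close>

definition face_neighbors :: "'a set set \<Rightarrow> nat \<Rightarrow> 'a set \<Rightarrow> 'a set \<Rightarrow> bool" where
  "face_neighbors X i \<sigma> \<sigma>' \<longleftrightarrow>
     \<sigma> \<in> faces X i \<and> \<sigma>' \<in> faces X i \<and> \<sigma> \<union> \<sigma>' \<in> faces X (i + 1)"

definition nonlazy_edges :: "nat \<Rightarrow> 'a set set \<Rightarrow> nat \<Rightarrow> 'a set \<Rightarrow> 'a set \<Rightarrow> nat" where
  "nonlazy_edges d X i \<sigma> \<sigma>' =
     (if face_neighbors X i \<sigma> \<sigma>' then face_deg d X (\<sigma> \<union> \<sigma>') else 0)"

text \<open>In dimension 0 every vertex gets as many self-loops as its degree in the multigraph without
  loops, so that the walk stays put with probability \<open>1/2\<close>. That degree is \<open>d\<close> times the number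
  of \<open>d\<close>-faces containing the vertex. A face is never its own neighbor, so there are no other
  loops.\<close>

definition high_order_edges :: "nat \<Rightarrow> 'a set set \<Rightarrow> nat \<Rightarrow> 'a set \<Rightarrow> 'a set \<Rightarrow> nat" where
  "high_order_edges d X i \<sigma> \<sigma>' =
     (if i = 0 \<and> \<sigma> = \<sigma>' then graph_deg (faces X 0) (nonlazy_edges d X 0) \<sigma>
      else nonlazy_edges d X i \<sigma> \<sigma>')"

end

theory Submission
  imports Defs
begin

text \<open>
  In the graph \<open>G\<^sub>i\<close> an \<open>i\<close>-face has degree \<open>(i+1)(d-i) deg\<close>, and every expanding face of \<open>W\<close> of
  degree \<open>k\<close> accounts for at least \<open>(i+1) k\<close> edges leaving \<open>W\<close>. Hence \<open>\<epsilon>\<close>-colorful expansion gives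
  conductance at least \<open>\<epsilon>/(i+2)\<close>, and Cheeger's inequality bounds the second eigenvalue by
  \<open>1 - \<epsilon>\<^sup>2/(2(i+2)\<^sup>2)\<close>. The smallest eigenvalue is at least \<open>-1/(i+1)\<close>, because the walk operator
  plus \<open>1/(i+1)\<close> is a multiple of the positive semidefinite up-down walk. For \<open>i \<ge> 1\<close> this is at
  least \<open>-1/2\<close>, which suffices since \<open>\<epsilon> \<le> 2\<close>. For \<open>i = 0\<close> laziness makes the spectrum nonnegative and
  halves the gap to \<open>\<epsilon>\<^sup>2/16\<close>, which is still large enough as \<open>2(d+1)\<^sup>2 \<ge> 18\<close> for \<open>d > 1\<close>.
\<close>

section \<open>Cheeger's inequality for weighted graphs\<close>

text \<open>Loops are allowed, so both the loopless face graphs and the lazy graph on vertices are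
  instances. Nonnegativity and symmetry are required on the whole type, which spares membership
  conditions later.\<close>

locale weighted_graph =
  fixes V :: "'v set" and w :: "'v \<Rightarrow> 'v \<Rightarrow> real"
  assumes finite_V: "finite V"
    and w_nonneg: "0 \<le> w u v"
    and w_sym: "w u v = w v u"
begin

definition wdeg :: "'v \<Rightarrow> real" where
  "wdeg v = (\<Sum>u\<in>V. w v u)"

definition sqnorm :: "('v \<Rightarrow> real) \<Rightarrow> real" where
  "sqnorm f = (\<Sum>v\<in>V. wdeg v * (f v)\<^sup>2)"

definition qform :: "('v \<Rightarrow> real) \<Rightarrow> ('v \<Rightarrow> real) \<Rightarrow> real" where
  "qform f g = (\<Sum>u\<in>V. \<Sum>v\<in>V. w u v * (f u * g v))"

text \<open>The sum runs over ordered pairs, so every edge between distinct vertices is counted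
  twice. This is the source of the factors 2 below.\<close>

definition energy :: "('v \<Rightarrow> real) \<Rightarrow> real" where
  "energy f = (\<Sum>u\<in>V. \<Sum>v\<in>V. w u v * (f u - f v)\<^sup>2)"

text \<open>A lower bound on the cut-to-volume ratio, stated as a predicate without division: no
  minimum over sets is formed and sets of zero volume need no exception.\<close>

definition conductance_ge :: "real \<Rightarrow> bool" where
  "conductance_ge h \<longleftrightarrow>
     (\<forall>S\<subseteq>V. sum wdeg S \<le> sum wdeg V / 2 \<longrightarrow> h * sum wdeg S \<le> (\<Sum>u\<in>S. \<Sum>v\<in>V - S. w u v))"

lemma wdeg_nonneg: "0 \<le> wdeg v"
  unfolding wdeg_def by (intro sum_nonneg w_nonneg)

lemma sqnorm_nonneg: "0 \<le> sqnorm f"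
  unfolding sqnorm_def by (intro sum_nonneg mult_nonneg_nonneg wdeg_nonneg) auto

lemma energy_nonneg: "0 \<le> energy f"
  unfolding energy_def by (intro sum_nonneg mult_nonneg_nonneg w_nonneg) auto

lemma sum_w_left: "(\<Sum>u\<in>V. \<Sum>v\<in>V. w u v * F u) = (\<Sum>u\<in>V. wdeg u * F u)"
  by (simp add: wdeg_def sum_distrib_right)

lemma sum_w_right: "(\<Sum>u\<in>V. \<Sum>v\<in>V. w u v * F v) = (\<Sum>u\<in>V. wdeg u * F u)"
proof -
  have "(\<Sum>u\<in>V. \<Sum>v\<in>V. w u v * F v) = (\<Sum>v\<in>V. \<Sum>u\<in>V. w v u * F v)"
    by (subst sum.swap) (simp add: w_sym)
  then show ?thesis by (simp add: sum_w_left)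
qed

lemma energy_eq: "energy f = 2 * sqnorm f - 2 * qform f f"
proof -
  have "energy f = (\<Sum>u\<in>V. \<Sum>v\<in>V. w u v * (f u)\<^sup>2) + (\<Sum>u\<in>V. \<Sum>v\<in>V. w u v * (f v)\<^sup>2) - 2 * qform f f"
    unfolding energy_def qform_def
    by (simp add: power2_diff algebra_simps sum.distrib sum_subtractf sum_distrib_left)
  then show ?thesis
    by (simp add: sum_w_left sum_w_right sqnorm_def)
qed

text \<open>Parallelogram identity: squares of sums and squares of differences add up to
  \<open>4 * sqnorm f\<close>, and the energy is nonnegative.\<close>

lemma sum_w_add_square_le: "(\<Sum>u\<in>V. \<Sum>v\<in>V. w u v * (f u + f v)\<^sup>2) \<le> 4 * sqnorm f"
proof -
  have "(\<Sum>u\<in>V. \<Sum>v\<in>V. w u v * (f u + f v)\<^sup>2) + energy f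
      = 2 * (\<Sum>u\<in>V. \<Sum>v\<in>V. w u v * (f u)\<^sup>2) + 2 * (\<Sum>u\<in>V. \<Sum>v\<in>V. w u v * (f v)\<^sup>2)"
    unfolding energy_def
    by (simp add: power2_diff power2_sum algebra_simps sum.distrib[symmetric] sum_distrib_left)
  then show ?thesis using energy_nonneg[of f]
    by (simp add: sum_w_left sum_w_right sqnorm_def)
qed

text \<open>The absolute difference of indicators is 1 exactly on pairs separated by
  \<open>S\<close>, and each such pair occurs in both orders.\<close>

lemma cut_indicator:
  assumes "S \<subseteq> V"
  shows "(\<Sum>u\<in>V. \<Sum>v\<in>V. w u v * \<bar>of_bool (u \<in> S) - of_bool (v \<in> S)\<bar>)
       = 2 * (\<Sum>u\<in>S. \<Sum>v\<in>V - S. w u v)"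
proof -
  have VS: "V \<inter> S = S" "V \<inter> {x. x \<notin> S} = V - S" using assms by auto
  have "(\<Sum>u\<in>V. \<Sum>v\<in>V. w u v * \<bar>of_bool (u \<in> S) - of_bool (v \<in> S)\<bar>)
      = (\<Sum>u\<in>V. \<Sum>v\<in>V. (if u \<in> S then if v \<notin> S then w u v else 0 else 0)
           + (if u \<notin> S then if v \<in> S then w u v else 0 else 0))"
    by (intro sum.cong refl) auto
  also have "\<dots> = (\<Sum>u\<in>S. \<Sum>v\<in>V - S. w u v) + (\<Sum>u\<in>V - S. \<Sum>v\<in>S. w u v)"
  proof -
    have "(\<Sum>u\<in>V. \<Sum>v\<in>V. (if u \<in> S then if v \<notin> S then w u v else 0 else 0))
        = (\<Sum>u\<in>V. if u \<in> S then (\<Sum>v\<in>V. if v \<notin> S then w u v else 0) else 0)"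
      by (intro sum.cong refl) auto
    moreover have "(\<Sum>u\<in>V. \<Sum>v\<in>V. (if u \<notin> S then if v \<in> S then w u v else 0 else 0))
        = (\<Sum>u\<in>V. if u \<notin> S then (\<Sum>v\<in>V. if v \<in> S then w u v else 0) else 0)"
      by (intro sum.cong refl) auto
    ultimately show ?thesis
      using finite_V by (simp add: sum.distrib sum.If_cases VS Collect_neg_eq Diff_eq Int_absorb1 assms)
  qed
  also have "(\<Sum>u\<in>V - S. \<Sum>v\<in>S. w u v) = (\<Sum>u\<in>S. \<Sum>v\<in>V - S. w u v)"
    by (subst sum.swap) (simp add: w_sym)
  finally show ?thesis by simp
qed

text \<open>Discrete co-area inequality: peel off the lowest level set and induct on the support.\<close>

lemma coarea:
  assumes h: "conductance_ge h"
    and "\<And>v. v \<in> V \<Longrightarrow> 0 \<le> F v"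
    and "sum wdeg {v \<in> V. 0 < F v} \<le> sum wdeg V / 2"
  shows "2 * h * (\<Sum>v\<in>V. wdeg v * F v) \<le> (\<Sum>u\<in>V. \<Sum>v\<in>V. w u v * \<bar>F u - F v\<bar>)"
  using assms(2,3)
proof (induction "card {v \<in> V. 0 < F v}" arbitrary: F rule: less_induct)
  case less
  define S where "S = {v \<in> V. 0 < F v}"
  have SV: "S \<subseteq> V" and fS: "finite S" using finite_V by (auto simp: S_def)
  show ?case
  proof (cases "S = {}")
    case True
    then have "F v = 0" if "v \<in> V" for v
      using less.prems(1)[OF that] that by (force simp: S_def)
    then show ?thesis by simp
  next
    case False
    define m where "m = Min (F ` S)"
    define F' where "F' v = F v - m * of_bool (v \<in> S)" for v
    have "m \<in> F ` S" unfolding m_def using False fS by simp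
    then obtain s where s: "s \<in> S" "F s = m" by auto
    have mpos: "0 < m" using s by (auto simp: S_def)
    have m_le: "m \<le> F v" if "v \<in> S" for v unfolding m_def using that fS by simp
    have F_zero: "F v = 0" if "v \<in> V" "v \<notin> S" for v
      using less.prems(1)[OF that(1)] that by (auto simp: S_def)
    have F'_nonneg: "0 \<le> F' v" if "v \<in> V" for v
      using m_le F_zero that by (cases "v \<in> S") (auto simp: F'_def)
    \<comment> \<open>Lowering \<open>F\<close> by its minimum \<open>m\<close> on \<open>S\<close>
      removes the minimizer \<open>s\<close> from the support, so the induction measure
      drops.\<close>
    have sub: "{v \<in> V. 0 < F' v} \<subseteq> S - {s}"
      using s by (auto simp: F'_def S_def of_bool_def split: if_splits)
    have "card {v \<in> V. 0 < F' v} < card S"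
      using psubset_card_mono[OF fS, of "{v \<in> V. 0 < F' v}"] sub s(1) by blast
    moreover have "sum wdeg {v \<in> V. 0 < F' v} \<le> sum wdeg V / 2"
    proof -
      have "sum wdeg {v \<in> V. 0 < F' v} \<le> sum wdeg S"
        using sub fS by (intro sum_mono2) (auto simp: wdeg_nonneg)
      then show ?thesis using less.prems(2) by (simp add: S_def)
    qed
    ultimately have IH: "2 * h * (\<Sum>v\<in>V. wdeg v * F' v) \<le> (\<Sum>u\<in>V. \<Sum>v\<in>V. w u v * \<bar>F' u - F' v\<bar>)"
      using less.hyps[of F'] F'_nonneg by (simp add: S_def)
    \<comment> \<open>Absolute differences add because the differences of \<open>F'\<close> and of
      the indicator never have opposite signs: \<open>F'\<close> vanishes off \<open>S\<close> and
      is nonnegative on it.\<close>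
    have split: "w u v * \<bar>F u - F v\<bar> = w u v * \<bar>F' u - F' v\<bar>
        + m * (w u v * \<bar>of_bool (u \<in> S) - of_bool (v \<in> S)\<bar>)" if "u \<in> V" "v \<in> V" for u v
    proof -
      have "\<bar>F u - F v\<bar> = \<bar>F' u - F' v\<bar> + m * \<bar>of_bool (u \<in> S) - of_bool (v \<in> S)\<bar>"
        using m_le[of u] m_le[of v] F_zero[OF that(1)] F_zero[OF that(2)] mpos
        by (auto simp: F'_def)
      then show ?thesis by (simp add: algebra_simps)
    qed
    have "(\<Sum>v\<in>V. wdeg v * F v) = (\<Sum>v\<in>V. wdeg v * F' v + m * (wdeg v * of_bool (v \<in> S)))"
      by (intro sum.cong refl) (simp add: F'_def algebra_simps)
    also have "\<dots> = (\<Sum>v\<in>V. wdeg v * F' v) + m * sum wdeg S"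
    proof -
      have "(\<Sum>v\<in>V. wdeg v * of_bool (v \<in> S)) = sum wdeg S"
        using SV finite_V by (simp add: Int_absorb1)
      then show ?thesis by (simp add: sum.distrib flip: sum_distrib_left)
    qed
    finally have "2 * h * (\<Sum>v\<in>V. wdeg v * F v)
        = 2 * h * (\<Sum>v\<in>V. wdeg v * F' v) + 2 * m * (h * sum wdeg S)"
      by (simp add: algebra_simps)
    also have "\<dots> \<le> (\<Sum>u\<in>V. \<Sum>v\<in>V. w u v * \<bar>F' u - F' v\<bar>) + 2 * m * (\<Sum>u\<in>S. \<Sum>v\<in>V - S. w u v)"
      using IH h SV less.prems(2) mpos
      by (intro add_mono mult_left_mono) (auto simp: conductance_ge_def S_def)
    also have "\<dots> = (\<Sum>u\<in>V. \<Sum>v\<in>V. w u v * \<bar>F' u - F' v\<bar>)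
        + m * (\<Sum>u\<in>V. \<Sum>v\<in>V. w u v * \<bar>of_bool (u \<in> S) - of_bool (v \<in> S)\<bar>)"
      by (simp add: cut_indicator[OF SV])
    also have "\<dots> = (\<Sum>u\<in>V. \<Sum>v\<in>V. w u v * \<bar>F u - F v\<bar>)"
      by (simp add: split sum.distrib sum_distrib_left)
    finally show ?thesis .
  qed
qed

text \<open>The usual inequality for vectors indexed by \<open>V \<times> V\<close>, with the weight
  shared as a square root between the two factors.\<close>

lemma Cauchy_Schwarz_w:
  "(\<Sum>u\<in>V. \<Sum>v\<in>V. w u v * \<bar>a u v * b u v\<bar>)\<^sup>2
     \<le> (\<Sum>u\<in>V. \<Sum>v\<in>V. w u v * (a u v)\<^sup>2) * (\<Sum>u\<in>V. \<Sum>v\<in>V. w u v * (b u v)\<^sup>2)"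
proof -
  let ?A = "\<lambda>(u, v). sqrt (w u v) * a u v" and ?B = "\<lambda>(u, v). sqrt (w u v) * b u v"
  have "(\<Sum>p\<in>V \<times> V. \<bar>?A p\<bar> * \<bar>?B p\<bar>)\<^sup>2 \<le> (L2_set ?A (V \<times> V) * L2_set ?B (V \<times> V))\<^sup>2"
    by (intro power_mono L2_set_mult_ineq sum_nonneg) auto
  also have "\<dots> = (\<Sum>p\<in>V \<times> V. (?A p)\<^sup>2) * (\<Sum>p\<in>V \<times> V. (?B p)\<^sup>2)"
    by (simp add: L2_set_def power_mult_distrib sum_nonneg)
  finally have "(\<Sum>p\<in>V \<times> V. \<bar>?A p\<bar> * \<bar>?B p\<bar>)\<^sup>2 \<le> (\<Sum>p\<in>V \<times> V. (?A p)\<^sup>2) * (\<Sum>p\<in>V \<times> V. (?B p)\<^sup>2)" .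
  moreover have "\<bar>?A p\<bar> * \<bar>?B p\<bar> = (\<lambda>(u, v). w u v * \<bar>a u v * b u v\<bar>) p"
    "(?A p)\<^sup>2 = (\<lambda>(u, v). w u v * (a u v)\<^sup>2) p" "(?B p)\<^sup>2 = (\<lambda>(u, v). w u v * (b u v)\<^sup>2) p" for p
    by (cases p, simp add: w_nonneg abs_mult power_mult_distrib)+
  ultimately show ?thesis
    by (simp add: sum.cartesian_product)
qed

text \<open>The co-area inequality is applied to the square of \<open>g\<close>, which has the same
  support. Factoring a difference of squares and using Cauchy-Schwarz bounds the result by the
  energy times \<open>4 * sqnorm g\<close>; one factor \<open>4 * sqnorm g\<close> then
  cancels.\<close>

lemma Cheeger_half_support:
  assumes h: "conductance_ge h" "0 \<le> h"
    and pos: "\<And>v. v \<in> V \<Longrightarrow> 0 \<le> g v"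
    and supp: "sum wdeg {v \<in> V. 0 < g v} \<le> sum wdeg V / 2"
  shows "h\<^sup>2 * sqnorm g \<le> energy g"
proof (cases "sqnorm g = 0")
  case True
  then show ?thesis by (simp add: energy_nonneg)
next
  case False
  then have sq: "0 < sqnorm g" using sqnorm_nonneg[of g] by simp
  have "{v \<in> V. 0 < (g v)\<^sup>2} = {v \<in> V. 0 < g v}"
    using pos by (auto simp: order_less_le)
  then have "2 * h * sqnorm g \<le> (\<Sum>u\<in>V. \<Sum>v\<in>V. w u v * \<bar>(g u)\<^sup>2 - (g v)\<^sup>2\<bar>)"
    unfolding sqnorm_def using coarea[OF h(1), of "\<lambda>v. (g v)\<^sup>2"] supp by simp
  then have "(2 * h * sqnorm g)\<^sup>2 \<le> (\<Sum>u\<in>V. \<Sum>v\<in>V. w u v * \<bar>(g u)\<^sup>2 - (g v)\<^sup>2\<bar>)\<^sup>2"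
    using h(2) sq by (intro power_mono) auto
  also have "\<dots> = (\<Sum>u\<in>V. \<Sum>v\<in>V. w u v * \<bar>(g u - g v) * (g u + g v)\<bar>)\<^sup>2"
    by (simp add: algebra_simps power2_eq_square)
  also have "\<dots> \<le> energy g * (\<Sum>u\<in>V. \<Sum>v\<in>V. w u v * (g u + g v)\<^sup>2)"
    unfolding energy_def by (rule Cauchy_Schwarz_w)
  also have "\<dots> \<le> energy g * (4 * sqnorm g)"
    by (intro mult_left_mono sum_w_add_square_le energy_nonneg)
  finally have "(h\<^sup>2 * sqnorm g) * (4 * sqnorm g) \<le> energy g * (4 * sqnorm g)"
    by (simp add: power2_eq_square algebra_simps)
  then show ?thesis using sq by simp
qed

text \<open>Let \<open>c\<close> be the least value of \<open>f\<close> whose strict upper level set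
  has at most half the mass. The next smaller value \<open>c'\<close>, if any, has an upper level
  set of more than half the mass, and that set is disjoint from the points below
  \<open>c\<close>.\<close>

lemma weighted_median:
  assumes "V \<noteq> {}"
  obtains c where "sum wdeg {v \<in> V. c < f v} \<le> sum wdeg V / 2"
    and "sum wdeg {v \<in> V. f v < (c :: real)} \<le> sum wdeg V / 2"
proof -
  define C where "C = {c \<in> f ` V. sum wdeg {v \<in> V. c < f v} \<le> sum wdeg V / 2}"
  have fin: "finite C" using finite_V by (simp add: C_def)
  have tot: "0 \<le> sum wdeg V" by (intro sum_nonneg wdeg_nonneg)
  have "{v \<in> V. Max (f ` V) < f v} = {}" using finite_V by (auto simp: not_less)
  then have "sum wdeg {v \<in> V. Max (f ` V) < f v} = 0" by (metis sum.empty)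
  then have "Max (f ` V) \<in> C" unfolding C_def using assms finite_V tot by simp
  then have ne: "C \<noteq> {}" by blast
  define c where "c = Min C"
  have cC: "c \<in> C" unfolding c_def using fin ne by simp
  show thesis
  proof (rule that)
    show "sum wdeg {v \<in> V. c < f v} \<le> sum wdeg V / 2" using cC by (simp add: C_def)
    define L where "L = {v \<in> V. f v < c}"
    have fL: "finite L" using finite_V by (simp add: L_def)
    have "sum wdeg L \<le> sum wdeg V / 2"
    proof (cases "L = {}")
      case True
      then show ?thesis using tot by simp
    next
      case False
      define c' where "c' = Max (f ` L)"
      have "c' \<in> f ` L" unfolding c'_def using False fL by simp
      then have c': "c' \<in> f ` V" "c' < c" by (auto simp: L_def)
      have "c' \<notin> C" using c'(2) Min_le[OF fin] by (force simp: c_def)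
      then have gt: "sum wdeg V / 2 < sum wdeg {v \<in> V. c' < f v}"
        using c'(1) by (simp add: C_def)
      have "f v \<le> c'" if "v \<in> L" for v unfolding c'_def using that fL by simp
      then have "{v \<in> V. c' < f v} \<subseteq> V - L" by force
      then have "sum wdeg {v \<in> V. c' < f v} \<le> sum wdeg (V - L)"
        using finite_V by (intro sum_mono2) (auto simp: wdeg_nonneg)
      also have "\<dots> = sum wdeg V - sum wdeg L"
        using finite_V by (intro sum_diff) (auto simp: L_def)
      finally show ?thesis using gt by simp
    qed
    then show "sum wdeg {v \<in> V. f v < c} \<le> sum wdeg V / 2" by (simp add: L_def)
  qed
qed

text \<open>Subtract a weighted median \<open>c\<close> and split \<open>f - c\<close> into positive
  and negative parts, each supported on at most half the mass. As \<open>f\<close> has weighted mean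
  zero, subtracting \<open>c\<close> cannot decrease the norm, and the energies of the parts sum to
  at most that of \<open>f\<close>.\<close>

theorem Cheeger:
  assumes h: "conductance_ge h" "0 \<le> h"
    and orth: "(\<Sum>v\<in>V. wdeg v * f v) = 0"
  shows "h\<^sup>2 * sqnorm f \<le> energy f"
proof (cases "V = {}")
  case True
  then show ?thesis unfolding sqnorm_def energy_def by simp
next
  case False
  obtain c where c: "sum wdeg {v \<in> V. c < f v} \<le> sum wdeg V / 2"
      "sum wdeg {v \<in> V. f v < c} \<le> sum wdeg V / 2"
    by (rule weighted_median[OF False])
  define p where "p v = max (f v - c) 0" for v
  define n where "n v = max (c - f v) 0" for v
  have "sqnorm p + sqnorm n = (\<Sum>v\<in>V. wdeg v * (f v)\<^sup>2 - 2 * c * (wdeg v * f v) + c\<^sup>2 * wdeg v)"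
    unfolding sqnorm_def sum.distrib[symmetric]
    by (intro sum.cong refl) (auto simp: p_def n_def max_def power2_eq_square algebra_simps)
  also have "\<dots> = sqnorm f + c\<^sup>2 * sum wdeg V"
    using orth by (simp add: sum.distrib sum_subtractf sqnorm_def flip: sum_distrib_left)
  finally have "sqnorm f \<le> sqnorm p + sqnorm n"
    by (simp add: sum_nonneg wdeg_nonneg)
  then have "h\<^sup>2 * sqnorm f \<le> h\<^sup>2 * sqnorm p + h\<^sup>2 * sqnorm n"
    by (metis distrib_left mult_left_mono zero_le_power2)
  also have "\<dots> \<le> energy p + energy n"
    using c by (intro add_mono Cheeger_half_support h) (auto simp: p_def n_def less_max_iff_disj)
  also have "\<dots> \<le> energy f"
  proof -
    have "(p u - p v)\<^sup>2 + (n u - n v)\<^sup>2 \<le> (f u - f v)\<^sup>2" for u v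
    proof -
      \<comment> \<open>\<open>p\<close> is nondecreasing and \<open>n\<close> nonincreasing as a
        function of the value of \<open>f\<close>.\<close>
      have "(p u - p v) * (n u - n v) \<le> 0"
        by (auto simp: p_def n_def max_def mult_le_0_iff)
      moreover have "f u - f v = (p u - p v) - (n u - n v)" by (auto simp: p_def n_def max_def)
      moreover have "x\<^sup>2 + y\<^sup>2 \<le> (x - y)\<^sup>2" if "x * y \<le> 0" for x y :: real
        using that by (simp add: power2_eq_square algebra_simps)
      ultimately show ?thesis by metis
    qed
    then show ?thesis
      unfolding energy_def sum.distrib[symmetric] distrib_left[symmetric]
      by (intro sum_mono mult_left_mono w_nonneg)
  qed
  finally show ?thesis .
qed

corollary qform_le_of_conductance:
  assumes "conductance_ge h" "0 \<le> h" "(\<Sum>v\<in>V. wdeg v * f v) = 0"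
  shows "qform f f \<le> (1 - h\<^sup>2 / 2) * sqnorm f"
  using Cheeger[OF assms] by (simp add: energy_eq algebra_simps)

section \<open>The averaging operator and its norm\<close>

text \<open>The random walk operator acting on functions; it is self-adjoint for the inner product
  weighted by \<open>wdeg\<close>, with \<open>qform\<close> as its bilinear form.\<close>

definition avg :: "('v \<Rightarrow> real) \<Rightarrow> 'v \<Rightarrow> real" where
  "avg f v = (\<Sum>u\<in>V. w v u * f u) / wdeg v"

lemma wdeg_avg:
  assumes "0 < wdeg v"
  shows "wdeg v * avg f v = (\<Sum>u\<in>V. w v u * f u)"
  using assms by (simp add: avg_def)

text \<open>Averaging preserves the weighted mean, so functions orthogonal to the constants stay
  so.\<close>

lemma sum_wdeg_avg:
  assumes "\<And>v. v \<in> V \<Longrightarrow> 0 < wdeg v"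
  shows "(\<Sum>v\<in>V. wdeg v * avg f v) = (\<Sum>v\<in>V. wdeg v * f v)"
  by (simp add: wdeg_avg assms sum_w_right)

lemma qform_avg:
  assumes "\<And>v. v \<in> V \<Longrightarrow> 0 < wdeg v"
  shows "qform f (avg f) = sqnorm (avg f)"
proof -
  have "qform f (avg f) = (\<Sum>v\<in>V. \<Sum>u\<in>V. w v u * f u * avg f v)"
    unfolding qform_def by (subst sum.swap) (simp add: w_sym mult.assoc)
  also have "\<dots> = (\<Sum>v\<in>V. wdeg v * avg f v * avg f v)"
    by (simp add: wdeg_avg assms sum_distrib_right)
  finally show ?thesis by (simp add: sqnorm_def power2_eq_square mult.assoc)
qed

text \<open>A self-adjoint operator is bounded by its numerical radius; by polarization this needs no
  eigenvectors.\<close>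

lemma sqnorm_avg_le:
  assumes pos: "\<And>v. v \<in> V \<Longrightarrow> 0 < wdeg v"
    and \<mu>: "0 < \<mu>"
    and bound: "\<And>g. (\<Sum>v\<in>V. wdeg v * g v) = 0 \<Longrightarrow> \<bar>qform g g\<bar> \<le> \<mu> * sqnorm g"
    and orth: "(\<Sum>v\<in>V. wdeg v * f v) = 0"
  shows "sqnorm (avg f) \<le> \<mu>\<^sup>2 * sqnorm f"
proof -
  define g where "g = avg f"
  \<comment> \<open>Polarization: the forms of \<open>p\<close> and \<open>q\<close> differ by
    \<open>4 * \<mu> * qform f g\<close>, which is \<open>4 * \<mu> * sqnorm g\<close>. The
    coefficient \<open>\<mu>\<close> of \<open>f\<close> is the one that makes the final bound
    exactly the square of \<open>\<mu>\<close> times \<open>sqnorm f\<close>.\<close>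
  define p where "p v = \<mu> * f v + g v" for v
  define q where "q v = \<mu> * f v - g v" for v
  have g0: "(\<Sum>v\<in>V. wdeg v * g v) = 0"
    unfolding g_def using sum_wdeg_avg[OF pos] orth by simp
  have lin: "(\<Sum>v\<in>V. wdeg v * p v) = 0" "(\<Sum>v\<in>V. wdeg v * q v) = 0"
    using orth g0
    by (simp_all add: p_def q_def algebra_simps sum.distrib sum_subtractf flip: sum_distrib_left)
  have sym: "qform g f = qform f g"
    unfolding qform_def by (subst sum.swap) (simp add: w_sym mult.commute)
  have "qform p p - qform q q = 2 * \<mu> * qform f g + 2 * \<mu> * qform g f"
    unfolding qform_def p_def q_def
    by (simp add: algebra_simps sum_distrib_left flip: sum.distrib sum_subtractf)
  then have "4 * \<mu> * sqnorm g = qform p p - qform q q"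
    using sym qform_avg[OF pos, of f] by (simp add: g_def)
  also have "\<dots> \<le> \<mu> * (sqnorm p + sqnorm q)"
    using bound[OF lin(1)] bound[OF lin(2)] by (simp add: algebra_simps)
  also have "sqnorm p + sqnorm q = 2 * \<mu>\<^sup>2 * sqnorm f + 2 * sqnorm g"
    unfolding sqnorm_def p_def q_def
    by (simp add: power2_eq_square algebra_simps sum_distrib_left flip: sum.distrib)
  finally have "4 * sqnorm g \<le> 2 * \<mu>\<^sup>2 * sqnorm f + 2 * sqnorm g"
    using \<mu> by (simp add: mult.assoc mult.left_commute[of _ \<mu>])
  then show ?thesis by (simp add: g_def)
qed

end

section \<open>Rapid mixing from a bound on the quadratic form\<close>

text \<open>Relative to the degrees, the deviation from stationarity evolves by \<open>avg\<close>
  and its weighted norm contracts by \<open>\<mu>\<close> in each step. Its initial squared norm is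
  at most \<open>1 / dmin\<close>, and passing from the weighted to the plain squared norm costs a
  factor \<open>dmax\<close>; this yields the factor \<open>sqrt (dmax / dmin)\<close>.\<close>

lemma rapidly_mixing_of_qform_bound:
  fixes V :: "'v set" and m :: "'v \<Rightarrow> 'v \<Rightarrow> nat"
  defines "D \<equiv> \<lambda>v. real (graph_deg V m v)"
  assumes fin: "finite V" and ne: "V \<noteq> {}"
    and sym: "\<And>u v. m u v = m v u"
    and pos: "\<And>v. v \<in> V \<Longrightarrow> 0 < D v"
    and \<mu>: "0 < \<mu>" "\<mu> < 1"
    and bound: "\<And>f. (\<Sum>v\<in>V. D v * f v) = 0 \<Longrightarrow>
      \<bar>\<Sum>u\<in>V. \<Sum>v\<in>V. real (m u v) * (f u * f v)\<bar> \<le> \<mu> * (\<Sum>v\<in>V. D v * (f v)\<^sup>2)"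
  shows "rapidly_mixing V m \<mu>"
proof -
  interpret weighted_graph V "\<lambda>u v. real (m u v)"
    by standard (auto simp: fin sym)
  have D: "wdeg = D"
    by (auto simp: fun_eq_iff wdeg_def D_def graph_deg_def)
  define T where "T = (\<Sum>v\<in>V. D v)"
  define st where "st v = D v / T" for v
  \<comment> \<open>The density of \<open>p - st\<close> with respect to the degree measure.\<close>
  define dens where "dens p v = p v / D v - 1 / T" for p v
  have T: "0 < T" unfolding T_def using fin ne pos by (intro sum_pos) auto
  \<comment> \<open>Reversibility: symmetry of \<open>m\<close> turns the step on distributions into
    averaging on densities.\<close>
  have step: "walk_step V m p v = D v * avg (\<lambda>u. p u / D u) v" if "v \<in> V" for p v
  proof -
    have "walk_step V m p v = (\<Sum>u\<in>V. real (m v u) * (p u / D u))"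
      unfolding walk_step_def walk_prob_def D_def
      by (intro sum.cong refl) (simp add: sym[of _ v])
    then show ?thesis using wdeg_avg[of v] pos[OF that] by (simp add: D)
  qed
  have avg_const: "avg (\<lambda>_. c) v = c" if "v \<in> V" for c v
    using pos[OF that] D by (simp add: avg_def wdeg_def fun_eq_iff flip: sum_distrib_right)
  have avg_diff: "avg (\<lambda>u. f u - g u) v = avg f v - avg g v" for f g v
    by (simp add: avg_def algebra_simps sum_subtractf diff_divide_distrib)
  have dens_step: "dens (walk_step V m p) v = avg (dens p) v" if "v \<in> V" for p v
    using step[OF that, of p] pos[OF that] avg_diff[of "\<lambda>u. p u / D u" "\<lambda>_. 1 / T" v]
    by (simp add: dens_def[abs_def] avg_const[OF that])
  have mass: "(\<Sum>v\<in>V. walk_step V m p v) = (\<Sum>v\<in>V. p v)" for p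
  proof -
    have "(\<Sum>v\<in>V. walk_step V m p v) = (\<Sum>v\<in>V. D v * (p v / D v))"
      using sum_wdeg_avg pos by (simp add: D step)
    then show ?thesis using pos by (simp add: less_imp_neq[symmetric] cong: sum.cong)
  qed
  have dens_orth: "(\<Sum>v\<in>V. D v * dens p v) = 0" if "(\<Sum>v\<in>V. p v) = 1" for p
  proof -
    have "(\<Sum>v\<in>V. D v * dens p v) = (\<Sum>v\<in>V. p v - D v / T)"
      using pos by (intro sum.cong refl) (simp add: dens_def field_simps less_imp_neq[symmetric])
    also have "\<dots> = 0" using that T by (simp add: sum_subtractf T_def flip: sum_divide_distrib)
    finally show ?thesis .
  qed
  have contract: "sqnorm (dens (walk_step V m p)) \<le> \<mu>\<^sup>2 * sqnorm (dens p)"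
    if "(\<Sum>v\<in>V. p v) = 1" for p
  proof -
    have "sqnorm (dens (walk_step V m p)) = sqnorm (avg (dens p))"
      unfolding sqnorm_def by (intro sum.cong refl) (simp add: dens_step)
    also have "\<dots> \<le> \<mu>\<^sup>2 * sqnorm (dens p)"
      using dens_orth[OF that] pos bound
      by (intro sqnorm_avg_le \<mu>) (auto simp: D qform_def sqnorm_def)
    finally show ?thesis .
  qed
  have stat: "stationary_distribution V m st"
  proof -
    have "walk_step V m st v = st v" if v: "v \<in> V" for v
    proof -
      have "avg (\<lambda>u. st u / D u) v = avg (\<lambda>_. 1 / T) v"
        unfolding avg_def st_def using pos
        by (intro arg_cong2[where f="(/)"] sum.cong refl) (simp add: less_imp_neq[symmetric])
      then show ?thesis using step[OF v, of st] avg_const[OF v] by (simp add: st_def)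
    qed
    moreover have "distribution_on V st"
      using T pos by (auto simp: distribution_on_def st_def T_def less_imp_le simp flip: sum_divide_distrib)
    ultimately show ?thesis by (simp add: stationary_distribution_def)
  qed
  define dmax where "dmax = real (Max (graph_deg V m ` V))"
  define dmin where "dmin = real (Min (graph_deg V m ` V))"
  have D_le: "D v \<le> dmax" and D_ge: "dmin \<le> D v" if "v \<in> V" for v
    using that fin by (auto simp: D_def dmax_def dmin_def)
  have dmin: "0 < dmin"
  proof -
    have "Min (graph_deg V m ` V) \<in> graph_deg V m ` V" using fin ne by simp
    then show ?thesis using pos by (auto simp: D_def dmin_def)
  qed
  have dmax: "0 \<le> dmax" by (simp add: dmax_def)
  have mix: "L2_set (\<lambda>v. (walk_step V m ^^ t) p v - st v) V \<le> sqrt (dmax / dmin) * \<mu> ^ t"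
    if p: "distribution_on V p" for p t
  proof -
    define P where "P t = (walk_step V m ^^ t) p" for t
    have P1: "(\<Sum>v\<in>V. P t v) = 1" for t
      using p by (induction t) (simp_all add: P_def distribution_on_def mass)
    have decay: "sqnorm (dens (P t)) \<le> (\<mu> ^ t)\<^sup>2 * sqnorm (dens p)" for t
    proof (induction t)
      case (Suc t)
      have "sqnorm (dens (P (Suc t))) \<le> \<mu>\<^sup>2 * sqnorm (dens (P t))"
        using contract[OF P1[of t]] by (simp add: P_def)
      also have "\<dots> \<le> \<mu>\<^sup>2 * ((\<mu> ^ t)\<^sup>2 * sqnorm (dens p))"
        using Suc by (intro mult_left_mono) auto
      finally show ?case by (simp add: power_mult_distrib mult.assoc)
    qed (simp add: P_def)
    \<comment> \<open>Expanding the square leaves the sum of \<open>(p v)\<^sup>2 / D v\<close>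
      minus \<open>1 / T\<close>; the first part is at most \<open>1 / dmin\<close> because
      probabilities are at most 1.\<close>
    have init: "sqnorm (dens p) \<le> 1 / dmin"
    proof -
      have "sqnorm (dens p) = (\<Sum>v\<in>V. (p v)\<^sup>2 / D v - 2 / T * p v + D v / T\<^sup>2)"
        unfolding sqnorm_def D using pos T
        by (intro sum.cong refl)
          (simp add: dens_def less_imp_neq[symmetric] field_simps power2_eq_square)
      also have "\<dots> = (\<Sum>v\<in>V. (p v)\<^sup>2 / D v) - 2 / T + 1 / T"
        using P1[of 0] T
        by (simp add: sum.distrib sum_subtractf P_def T_def power2_eq_square
              flip: sum_distrib_left sum_divide_distrib)
      also have "\<dots> \<le> (\<Sum>v\<in>V. (p v)\<^sup>2 / D v)" using T by simp
      also have "\<dots> \<le> (\<Sum>v\<in>V. p v / dmin)"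
      proof (rule sum_mono)
        fix v assume v: "v \<in> V"
        have p0: "0 \<le> p v" using p v by (simp add: distribution_on_def)
        have "p v \<le> (\<Sum>v\<in>V. p v)"
          using p v fin by (intro member_le_sum) (auto simp: distribution_on_def)
        then have "p v \<le> 1" using P1[of 0] by (simp add: P_def)
        then have "(p v)\<^sup>2 \<le> p v"
          using p0 mult_left_mono[of "p v" 1 "p v"] by (simp add: power2_eq_square)
        then show "(p v)\<^sup>2 / D v \<le> p v / dmin"
          using p0 D_ge[OF v] dmin by (intro frac_le) auto
      qed
      also have "\<dots> = 1 / dmin" using P1[of 0] by (simp add: P_def flip: sum_divide_distrib)
      finally show ?thesis .
    qed
    have "(L2_set (\<lambda>v. P t v - st v) V)\<^sup>2 = (\<Sum>v\<in>V. (P t v - st v)\<^sup>2)"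
      by (simp add: L2_set_def sum_nonneg)
    also have "\<dots> \<le> (\<Sum>v\<in>V. dmax * (D v * (dens (P t) v)\<^sup>2))"
    proof (rule sum_mono)
      fix v assume v: "v \<in> V"
      have "P t v - st v = D v * dens (P t) v"
        using pos[OF v] T by (simp add: dens_def st_def field_simps)
      then have "(P t v - st v)\<^sup>2 = D v * (D v * (dens (P t) v)\<^sup>2)"
        by (simp add: power2_eq_square)
      also have "\<dots> \<le> dmax * (D v * (dens (P t) v)\<^sup>2)"
        using D_le[OF v] pos[OF v] by (intro mult_right_mono) auto
      finally show "(P t v - st v)\<^sup>2 \<le> dmax * (D v * (dens (P t) v)\<^sup>2)" .
    qed
    also have "\<dots> = dmax * sqnorm (dens (P t))"
      by (simp add: sqnorm_def D sum_distrib_left)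
    also have "\<dots> \<le> dmax * ((\<mu> ^ t)\<^sup>2 * (1 / dmin))"
    proof -
      have "sqnorm (dens (P t)) \<le> (\<mu> ^ t)\<^sup>2 * sqnorm (dens p)" by (rule decay)
      also have "\<dots> \<le> (\<mu> ^ t)\<^sup>2 * (1 / dmin)" using init by (intro mult_left_mono) auto
      finally show ?thesis using dmax by (intro mult_left_mono)
    qed
    also have "\<dots> = (sqrt (dmax / dmin) * \<mu> ^ t)\<^sup>2"
      using dmax dmin by (simp add: power_mult_distrib)
    finally have "(L2_set (\<lambda>v. P t v - st v) V)\<^sup>2 \<le> (sqrt (dmax / dmin) * \<mu> ^ t)\<^sup>2" .
    moreover have "0 \<le> sqrt (dmax / dmin) * \<mu> ^ t" using dmax dmin \<mu> by simp
    ultimately show ?thesis unfolding P_def by (rule power2_le_imp_le)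
  qed
  show ?thesis
    unfolding rapidly_mixing_def using \<mu> stat mix by (auto simp: dmax_def dmin_def)
qed

section \<open>Counting in pure simplicial complexes\<close>

locale pure_complex =
  fixes d :: nat and X :: "'a set set"
  assumes pure: "pure_simplicial_complex d X"
begin

abbreviation deg :: "'a set \<Rightarrow> real" where
  "deg \<sigma> \<equiv> real (face_deg d X \<sigma>)"

definition facets :: "nat \<Rightarrow> 'a set \<Rightarrow> 'a set set" where
  "facets i \<tau> = {\<sigma> \<in> faces X i. \<sigma> \<subset> \<tau>}"

lemma finite_faces: "finite (faces X i)"
  using pure by (simp add: pure_simplicial_complex_def faces_def)

lemma finite_facets: "finite (facets i \<tau>)"
  using finite_faces by (simp add: facets_def)

lemma finite_face: "\<sigma> \<in> faces X i \<Longrightarrow> finite \<sigma>"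
  using pure by (auto simp: pure_simplicial_complex_def faces_def)

lemma card_face: "\<sigma> \<in> faces X i \<Longrightarrow> card \<sigma> = i + 1"
  by (simp add: faces_def)

lemma subface: "\<tau> \<in> faces X j \<Longrightarrow> \<sigma> \<subseteq> \<tau> \<Longrightarrow> card \<sigma> = i + 1 \<Longrightarrow> \<sigma> \<in> faces X i"
  using pure by (auto simp: pure_simplicial_complex_def faces_def)

lemma deg_pos:
  assumes "\<sigma> \<in> faces X i"
  shows "0 < deg \<sigma>"
proof -
  have "{\<tau> \<in> faces X d. \<sigma> \<subseteq> \<tau>} \<noteq> {}"
    using assms pure by (auto simp: pure_simplicial_complex_def faces_def)
  then show ?thesis using finite_faces by (simp add: face_deg_def card_gt_0_iff)
qed

lemma faces_nonempty:
  assumes "i \<le> d"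
  shows "faces X i \<noteq> {}"
proof -
  have "X \<noteq> {}" "\<forall>\<sigma>\<in>X. \<exists>\<tau>\<in>faces X d. \<sigma> \<subseteq> \<tau>"
    using pure by (simp_all add: pure_simplicial_complex_def)
  then obtain \<rho> where \<rho>: "\<rho> \<in> faces X d" by auto
  obtain \<sigma> where "\<sigma> \<subseteq> \<rho>" "card \<sigma> = i + 1"
    using obtain_subset_with_card_n[of "i + 1" \<rho>] card_face[OF \<rho>] assms by auto
  then have "\<sigma> \<in> faces X i" by (rule subface[OF \<rho>])
  then show ?thesis by auto
qed

section \<open>Incidence counts between consecutive dimensions\<close>

text \<open>A facet arises by deleting one vertex, and an \<open>(i+1)\<close>-face has
  \<open>i + 2\<close> vertices.\<close>

lemma card_facets:
  assumes \<tau>: "\<tau> \<in> faces X (i + 1)"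
  shows "card (facets i \<tau>) = i + 2"
proof -
  have ft: "finite \<tau>" "card \<tau> = i + 2" using finite_face[OF \<tau>] card_face[OF \<tau>] by auto
  have "facets i \<tau> = (\<lambda>x. \<tau> - {x}) ` \<tau>"
  proof (intro equalityI subsetI)
    fix \<sigma> assume "\<sigma> \<in> facets i \<tau>"
    then have \<sigma>: "\<sigma> \<in> faces X i" "\<sigma> \<subset> \<tau>" by (auto simp: facets_def)
    have "card (\<tau> - \<sigma>) = 1"
      using \<sigma> ft card_face[OF \<sigma>(1)] finite_face[OF \<sigma>(1)] by (subst card_Diff_subset) auto
    then obtain x where "\<tau> - \<sigma> = {x}" by (auto simp: card_1_singleton_iff)
    then have "x \<in> \<tau>" "\<sigma> = \<tau> - {x}" using \<sigma>(2) by blast+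
    then show "\<sigma> \<in> (\<lambda>x. \<tau> - {x}) ` \<tau>" by blast
  next
    fix \<sigma> assume "\<sigma> \<in> (\<lambda>x. \<tau> - {x}) ` \<tau>"
    then obtain x where x: "x \<in> \<tau>" "\<sigma> = \<tau> - {x}" by blast
    then have "card \<sigma> = i + 1" using ft by simp
    then show "\<sigma> \<in> facets i \<tau>" using subface[OF \<tau>, of \<sigma> i] x by (auto simp: facets_def)
  qed
  moreover have "inj_on (\<lambda>x. \<tau> - {x}) \<tau>" by (auto simp: inj_on_def)
  ultimately show ?thesis using ft by (simp add: card_image)
qed

text \<open>Such a face is \<sigma> together with one of the \<open>(d + 1) - (i + 1)\<close>
  vertices of \<rho> outside \<sigma>.\<close>

lemma card_between:
  assumes \<sigma>: "\<sigma> \<in> faces X i" and \<rho>: "\<rho> \<in> faces X d" and sub: "\<sigma> \<subseteq> \<rho>"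
  shows "card {\<tau> \<in> faces X (i + 1). \<sigma> \<subset> \<tau> \<and> \<tau> \<subseteq> \<rho>} = d - i"
proof -
  have f\<sigma>: "finite \<sigma>" "card \<sigma> = i + 1" using finite_face[OF \<sigma>] card_face[OF \<sigma>] by auto
  have "{\<tau> \<in> faces X (i + 1). \<sigma> \<subset> \<tau> \<and> \<tau> \<subseteq> \<rho>} = (\<lambda>x. insert x \<sigma>) ` (\<rho> - \<sigma>)"
  proof (intro equalityI subsetI)
    fix \<tau> assume "\<tau> \<in> {\<tau> \<in> faces X (i + 1). \<sigma> \<subset> \<tau> \<and> \<tau> \<subseteq> \<rho>}"
    then have \<tau>: "\<tau> \<in> faces X (i + 1)" "\<sigma> \<subset> \<tau>" "\<tau> \<subseteq> \<rho>" by auto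
    have "card (\<tau> - \<sigma>) = 1"
      using \<tau> f\<sigma> card_face[OF \<tau>(1)] by (subst card_Diff_subset) auto
    then obtain x where "\<tau> - \<sigma> = {x}" by (auto simp: card_1_singleton_iff)
    then have "x \<in> \<rho> - \<sigma>" "\<tau> = insert x \<sigma>" using \<tau>(2,3) by blast+
    then show "\<tau> \<in> (\<lambda>x. insert x \<sigma>) ` (\<rho> - \<sigma>)" by blast
  next
    fix \<tau> assume "\<tau> \<in> (\<lambda>x. insert x \<sigma>) ` (\<rho> - \<sigma>)"
    then obtain x where x: "x \<in> \<rho>" "x \<notin> \<sigma>" "\<tau> = insert x \<sigma>" by blast
    then have "card \<tau> = i + 1 + 1" using f\<sigma> by simp
    then show "\<tau> \<in> {\<tau> \<in> faces X (i + 1). \<sigma> \<subset> \<tau> \<and> \<tau> \<subseteq> \<rho>}"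
      using subface[OF \<rho>, of \<tau> "i + 1"] x sub by auto
  qed
  moreover have "inj_on (\<lambda>x. insert x \<sigma>) (\<rho> - \<sigma>)" by (auto simp: inj_on_def)
  ultimately show ?thesis
    using f\<sigma> sub card_face[OF \<rho>] by (simp add: card_image card_Diff_subset)
qed

lemma deg_eq_sum: "deg \<tau> = (\<Sum>\<rho>\<in>faces X d. of_bool (\<tau> \<subseteq> \<rho>))"
  using finite_faces by (simp add: face_deg_def Int_def)

text \<open>Double counting of the pairs of a coface \<tau> of \<sigma> and a \<open>d\<close>-face
  \<rho> containing \<tau>.\<close>

lemma sum_deg_cofaces:
  assumes \<sigma>: "\<sigma> \<in> faces X i"
  shows "(\<Sum>\<tau> | \<tau> \<in> faces X (i + 1) \<and> \<sigma> \<subset> \<tau>. deg \<tau>) = real (d - i) * deg \<sigma>"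
proof -
  have "(\<Sum>\<tau> | \<tau> \<in> faces X (i + 1) \<and> \<sigma> \<subset> \<tau>. deg \<tau>)
      = (\<Sum>\<rho>\<in>faces X d. \<Sum>\<tau> | \<tau> \<in> faces X (i + 1) \<and> \<sigma> \<subset> \<tau>. of_bool (\<tau> \<subseteq> \<rho>))"
    unfolding deg_eq_sum by (rule sum.swap)
  also have "\<dots> = (\<Sum>\<rho>\<in>faces X d. real (d - i) * of_bool (\<sigma> \<subseteq> \<rho>))"
  proof (rule sum.cong[OF refl])
    fix \<rho> assume \<rho>: "\<rho> \<in> faces X d"
    have "(\<Sum>\<tau> | \<tau> \<in> faces X (i + 1) \<and> \<sigma> \<subset> \<tau>. of_bool (\<tau> \<subseteq> \<rho>))
        = real (card {\<tau> \<in> faces X (i + 1). \<sigma> \<subset> \<tau> \<and> \<tau> \<subseteq> \<rho>})"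
      using finite_faces by (simp add: Int_def conj_assoc)
    also have "\<dots> = real (d - i) * of_bool (\<sigma> \<subseteq> \<rho>)"
    proof (cases "\<sigma> \<subseteq> \<rho>")
      case True
      then show ?thesis using card_between[OF \<sigma> \<rho>] by simp
    next
      case False
      then have "{\<tau> \<in> faces X (i + 1). \<sigma> \<subset> \<tau> \<and> \<tau> \<subseteq> \<rho>} = {}" by blast
      then have "card {\<tau> \<in> faces X (i + 1). \<sigma> \<subset> \<tau> \<and> \<tau> \<subseteq> \<rho>} = 0" by (metis card.empty)
      then show ?thesis using False by simp
    qed
    finally show "(\<Sum>\<tau> | \<tau> \<in> faces X (i + 1) \<and> \<sigma> \<subset> \<tau>. of_bool (\<tau> \<subseteq> \<rho>))
        = real (d - i) * of_bool (\<sigma> \<subseteq> \<rho>)" .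
  qed
  finally show ?thesis by (simp only: deg_eq_sum sum_distrib_left)
qed

text \<open>Transfers weighted sums from dimension \<open>i + 1\<close> to dimension
  \<open>i\<close>: after exchanging the sums, each \<open>i\<close>-face collects the degrees of
  its cofaces.\<close>

lemma sum_deg_facets:
  "(\<Sum>\<tau>\<in>faces X (i + 1). deg \<tau> * (\<Sum>\<sigma>\<in>facets i \<tau>. g \<sigma>))
     = real (d - i) * (\<Sum>\<sigma>\<in>faces X i. deg \<sigma> * g \<sigma>)"
proof -
  have "(\<Sum>\<tau>\<in>faces X (i + 1). deg \<tau> * (\<Sum>\<sigma>\<in>facets i \<tau>. g \<sigma>))
      = (\<Sum>\<tau>\<in>faces X (i + 1). \<Sum>\<sigma> | \<sigma> \<in> faces X i \<and> \<sigma> \<subset> \<tau>. deg \<tau> * g \<sigma>)"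
    by (simp add: facets_def sum_distrib_left)
  also have "\<dots> = (\<Sum>\<sigma>\<in>faces X i. \<Sum>\<tau> | \<tau> \<in> faces X (i + 1) \<and> \<sigma> \<subset> \<tau>. deg \<tau> * g \<sigma>)"
    by (rule sum.swap_restrict[OF finite_faces finite_faces])
  also have "\<dots> = (\<Sum>\<sigma>\<in>faces X i. real (d - i) * deg \<sigma> * g \<sigma>)"
    using sum_deg_cofaces by (simp flip: sum_distrib_right)
  finally show ?thesis by (simp add: sum_distrib_left mult.assoc)
qed

text \<open>The case of a constant function. It relates the denominators of
  \<open>cochain_norm\<close> in consecutive dimensions.\<close>

lemma total_deg_step:
  "(real i + 2) * (\<Sum>\<tau>\<in>faces X (i + 1). deg \<tau>) = real (d - i) * (\<Sum>\<sigma>\<in>faces X i. deg \<sigma>)"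
proof -
  have "(\<Sum>\<tau>\<in>faces X (i + 1). deg \<tau> * (\<Sum>\<sigma>\<in>facets i \<tau>. 1)) = (\<Sum>\<tau>\<in>faces X (i + 1). (real i + 2) * deg \<tau>)"
    by (intro sum.cong refl) (simp add: card_facets)
  then show ?thesis
    using sum_deg_facets[where g = "\<lambda>_. 1" and i = i] by (simp add: sum_distrib_left)
qed

section \<open>The walk graph as a union of cliques\<close>

text \<open>Two distinct facets of \<tau> together have more than \<open>i + 1\<close> vertices, all
  among the \<open>i + 2\<close> vertices of \<tau>, so their union is \<tau>.\<close>

lemma facet_pair_iff:
  assumes \<tau>: "\<tau> \<in> faces X (i + 1)"
  shows "\<sigma> \<in> facets i \<tau> \<and> \<sigma>' \<in> facets i \<tau> \<and> \<sigma> \<noteq> \<sigma>' \<longleftrightarrow> face_neighbors X i \<sigma> \<sigma>' \<and> \<tau> = \<sigma> \<union> \<sigma>'"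
proof
  assume A: "\<sigma> \<in> facets i \<tau> \<and> \<sigma>' \<in> facets i \<tau> \<and> \<sigma> \<noteq> \<sigma>'"
  then have s: "\<sigma> \<in> faces X i" "\<sigma>' \<in> faces X i" "\<sigma> \<union> \<sigma>' \<subseteq> \<tau>" by (auto simp: facets_def)
  have "\<not> \<sigma>' \<subseteq> \<sigma>"
    using A s card_subset_eq[of \<sigma> \<sigma>'] card_face[of _ i] finite_face by metis
  then have "card \<sigma> < card (\<sigma> \<union> \<sigma>')"
    using s finite_face by (intro psubset_card_mono) auto
  then have "\<sigma> \<union> \<sigma>' = \<tau>"
    using s \<tau> card_face[of \<tau> "i + 1"] card_face[of \<sigma> i] finite_face card_mono[of \<tau> "\<sigma> \<union> \<sigma>'"]
    by (intro card_subset_eq) auto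
  then show "face_neighbors X i \<sigma> \<sigma>' \<and> \<tau> = \<sigma> \<union> \<sigma>'"
    using s \<tau> by (auto simp: face_neighbors_def)
next
  assume A: "face_neighbors X i \<sigma> \<sigma>' \<and> \<tau> = \<sigma> \<union> \<sigma>'"
  then have "\<sigma> \<in> faces X i" "\<sigma>' \<in> faces X i" "\<tau> = \<sigma> \<union> \<sigma>'" by (auto simp: face_neighbors_def)
  moreover from this have "\<sigma> \<noteq> \<tau>" "\<sigma>' \<noteq> \<tau>"
    using card_face[OF \<tau>] card_face[of _ i] by auto
  ultimately show "\<sigma> \<in> facets i \<tau> \<and> \<sigma>' \<in> facets i \<tau> \<and> \<sigma> \<noteq> \<sigma>'"
    by (auto simp: facets_def)
qed

text \<open>At most one summand is nonzero, namely the one for the union of the two faces.\<close>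

lemma nonlazy_edges_eq_sum:
  "real (nonlazy_edges d X i \<sigma> \<sigma>')
     = (\<Sum>\<tau>\<in>faces X (i + 1). deg \<tau> * of_bool (\<sigma> \<in> facets i \<tau> \<and> \<sigma>' \<in> facets i \<tau> \<and> \<sigma> \<noteq> \<sigma>'))"
proof -
  have "(\<Sum>\<tau>\<in>faces X (i + 1). deg \<tau> * of_bool (\<sigma> \<in> facets i \<tau> \<and> \<sigma>' \<in> facets i \<tau> \<and> \<sigma> \<noteq> \<sigma>'))
      = (\<Sum>\<tau>\<in>faces X (i + 1). if \<tau> = \<sigma> \<union> \<sigma>' then real (nonlazy_edges d X i \<sigma> \<sigma>') else 0)"
    by (intro sum.cong refl) (simp only: facet_pair_iff, simp add: nonlazy_edges_def)
  also have "\<dots> = (if \<sigma> \<union> \<sigma>' \<in> faces X (i + 1) then real (nonlazy_edges d X i \<sigma> \<sigma>') else 0)"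
    using finite_faces by (simp add: sum.delta)
  also have "\<dots> = real (nonlazy_edges d X i \<sigma> \<sigma>')"
    by (simp add: nonlazy_edges_def face_neighbors_def)
  finally show ?thesis by simp
qed

text \<open>Each \<open>(i+1)\<close>-face \<tau> contributes a complete graph on its facets in
  which every edge has multiplicity \<open>deg \<tau>\<close>. All facts about the edges are derived
  from this decomposition by a choice of \<open>F\<close>.\<close>

lemma sum_nonlazy_edges:
  "(\<Sum>\<sigma>\<in>faces X i. \<Sum>\<sigma>'\<in>faces X i. real (nonlazy_edges d X i \<sigma> \<sigma>') * F \<sigma> \<sigma>')
     = (\<Sum>\<tau>\<in>faces X (i + 1). deg \<tau> * (\<Sum>\<sigma>\<in>facets i \<tau>. \<Sum>\<sigma>'\<in>facets i \<tau> - {\<sigma>}. F \<sigma> \<sigma>'))"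
proof -
  let ?b = "\<lambda>\<tau> \<sigma> \<sigma>'. of_bool (\<sigma> \<in> facets i \<tau> \<and> \<sigma>' \<in> facets i \<tau> \<and> \<sigma> \<noteq> \<sigma>') :: real"
  have sub: "facets i \<tau> \<subseteq> faces X i" for \<tau> by (auto simp: facets_def)
  have "(\<Sum>\<sigma>\<in>faces X i. \<Sum>\<sigma>'\<in>faces X i. real (nonlazy_edges d X i \<sigma> \<sigma>') * F \<sigma> \<sigma>')
      = (\<Sum>\<sigma>\<in>faces X i. \<Sum>\<sigma>'\<in>faces X i. \<Sum>\<tau>\<in>faces X (i + 1). deg \<tau> * (?b \<tau> \<sigma> \<sigma>' * F \<sigma> \<sigma>'))"
    by (simp only: nonlazy_edges_eq_sum sum_distrib_right mult.assoc)
  also have "\<dots> = (\<Sum>\<sigma>\<in>faces X i. \<Sum>\<tau>\<in>faces X (i + 1). \<Sum>\<sigma>'\<in>faces X i. deg \<tau> * (?b \<tau> \<sigma> \<sigma>' * F \<sigma> \<sigma>'))"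
    by (intro sum.cong refl sum.swap)
  also have "\<dots> = (\<Sum>\<tau>\<in>faces X (i + 1). \<Sum>\<sigma>\<in>faces X i. \<Sum>\<sigma>'\<in>faces X i. deg \<tau> * (?b \<tau> \<sigma> \<sigma>' * F \<sigma> \<sigma>'))"
    by (rule sum.swap)
  also have "\<dots> = (\<Sum>\<tau>\<in>faces X (i + 1). deg \<tau> * (\<Sum>\<sigma>\<in>facets i \<tau>. \<Sum>\<sigma>'\<in>facets i \<tau> - {\<sigma>}. F \<sigma> \<sigma>'))"
  proof (rule sum.cong[OF refl])
    fix \<tau>
    have "(\<Sum>\<sigma>\<in>facets i \<tau>. \<Sum>\<sigma>'\<in>facets i \<tau> - {\<sigma>}. F \<sigma> \<sigma>')
        = (\<Sum>\<sigma>\<in>facets i \<tau>. \<Sum>\<sigma>'\<in>faces X i. ?b \<tau> \<sigma> \<sigma>' * F \<sigma> \<sigma>')"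
      using sub[of \<tau>] by (intro sum.cong refl sum.mono_neutral_cong_left finite_faces) auto
    also have "\<dots> = (\<Sum>\<sigma>\<in>faces X i. \<Sum>\<sigma>'\<in>faces X i. ?b \<tau> \<sigma> \<sigma>' * F \<sigma> \<sigma>')"
      using sub[of \<tau>] by (intro sum.mono_neutral_left finite_faces) auto
    finally show "(\<Sum>\<sigma>\<in>faces X i. \<Sum>\<sigma>'\<in>faces X i. deg \<tau> * (?b \<tau> \<sigma> \<sigma>' * F \<sigma> \<sigma>'))
        = deg \<tau> * (\<Sum>\<sigma>\<in>facets i \<tau>. \<Sum>\<sigma>'\<in>facets i \<tau> - {\<sigma>}. F \<sigma> \<sigma>')"
      by (simp only: sum_distrib_left)
  qed
  finally show ?thesis .
qed

lemma nonlazy_edges_sym: "nonlazy_edges d X i \<sigma> \<sigma>' = nonlazy_edges d X i \<sigma>' \<sigma>"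
  by (auto simp: nonlazy_edges_def face_neighbors_def Un_commute)

text \<open>With the indicator of \<sigma> as test function, each coface of \<sigma> contributes its
  degree once for each of its \<open>i + 1\<close> other facets.\<close>

lemma nonlazy_degree:
  assumes \<sigma>: "\<sigma> \<in> faces X i"
  shows "(\<Sum>\<sigma>'\<in>faces X i. real (nonlazy_edges d X i \<sigma> \<sigma>')) = (real i + 1) * real (d - i) * deg \<sigma>"
proof -
  have "(\<Sum>\<sigma>'\<in>faces X i. real (nonlazy_edges d X i \<sigma> \<sigma>'))
      = (\<Sum>s\<in>faces X i. if s = \<sigma> then (\<Sum>\<sigma>'\<in>faces X i. real (nonlazy_edges d X i s \<sigma>')) else 0)"
    using \<sigma> finite_faces by (simp add: sum.delta)
  also have "\<dots> = (\<Sum>s\<in>faces X i. \<Sum>\<sigma>'\<in>faces X i. real (nonlazy_edges d X i s \<sigma>') * of_bool (s = \<sigma>))"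
    by (intro sum.cong refl) simp
  also have "\<dots> = (\<Sum>\<tau>\<in>faces X (i + 1). deg \<tau> * (\<Sum>s\<in>facets i \<tau>. (real i + 1) * of_bool (s = \<sigma>)))"
    unfolding sum_nonlazy_edges
    by (intro sum.cong refl arg_cong2[where f="(*)"]) (simp add: card_facets finite_facets)
  also have "\<dots> = real (d - i) * (\<Sum>s\<in>faces X i. if s = \<sigma> then (real i + 1) * deg \<sigma> else 0)"
    unfolding sum_deg_facets by (intro sum.cong arg_cong2[where f="(*)"] refl) auto
  finally show ?thesis using \<sigma> finite_faces by (simp add: sum.delta)
qed

text \<open>The form plus its diagonal part is a sum over \<open>(i+1)\<close>-faces of squares of facet sums.\<close>

lemma nonlazy_form_ge:
  "- real (d - i) * (\<Sum>\<sigma>\<in>faces X i. deg \<sigma> * (f \<sigma>)\<^sup>2)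
     \<le> (\<Sum>\<sigma>\<in>faces X i. \<Sum>\<sigma>'\<in>faces X i. real (nonlazy_edges d X i \<sigma> \<sigma>') * (f \<sigma> * f \<sigma>'))"
proof -
  have "(\<Sum>\<sigma>\<in>facets i \<tau>. \<Sum>\<sigma>'\<in>facets i \<tau> - {\<sigma>}. f \<sigma> * f \<sigma>')
      = (\<Sum>\<sigma>\<in>facets i \<tau>. f \<sigma>)\<^sup>2 - (\<Sum>\<sigma>\<in>facets i \<tau>. (f \<sigma>)\<^sup>2)" for \<tau>
  proof -
    have "(\<Sum>\<sigma>\<in>facets i \<tau>. \<Sum>\<sigma>'\<in>facets i \<tau> - {\<sigma>}. f \<sigma> * f \<sigma>')
        = (\<Sum>\<sigma>\<in>facets i \<tau>. f \<sigma> * (\<Sum>\<sigma>'\<in>facets i \<tau>. f \<sigma>') - (f \<sigma>)\<^sup>2)"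
      by (intro sum.cong refl)
        (simp add: sum_diff1 finite_facets power2_eq_square right_diff_distrib
          sum_distrib_left[symmetric])
    then show ?thesis
      by (simp add: sum_subtractf power2_eq_square flip: sum_distrib_right)
  qed
  then have "(\<Sum>\<sigma>\<in>faces X i. \<Sum>\<sigma>'\<in>faces X i. real (nonlazy_edges d X i \<sigma> \<sigma>') * (f \<sigma> * f \<sigma>'))
      = (\<Sum>\<tau>\<in>faces X (i + 1). deg \<tau> * (\<Sum>\<sigma>\<in>facets i \<tau>. f \<sigma>)\<^sup>2)
        - real (d - i) * (\<Sum>\<sigma>\<in>faces X i. deg \<sigma> * (f \<sigma>)\<^sup>2)"
    unfolding sum_nonlazy_edges sum_deg_facets[symmetric] by (simp add: right_diff_distrib sum_subtractf)
  moreover have "0 \<le> (\<Sum>\<tau>\<in>faces X (i + 1). deg \<tau> * (\<Sum>\<sigma>\<in>facets i \<tau>. f \<sigma>)\<^sup>2)"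
    by (intro sum_nonneg) simp
  ultimately show ?thesis by simp
qed

text \<open>A face of \<open>\<psi>(S)\<close> with \<open>a\<close> facets inside and \<open>b\<close> outside \<open>S\<close> contributes
  \<open>a b \<ge> a + b - 1 = i + 1\<close> crossing pairs.\<close>

lemma nonlazy_cut_ge:
  assumes S: "S \<subseteq> faces X i"
  shows "(real i + 1) * (\<Sum>\<tau>\<in>expanding_faces X i S. deg \<tau>)
     \<le> (\<Sum>\<sigma>\<in>S. \<Sum>\<sigma>'\<in>faces X i - S. real (nonlazy_edges d X i \<sigma> \<sigma>'))"
proof -
  let ?F = "\<lambda>\<sigma> \<sigma>'. of_bool (\<sigma> \<in> S \<and> \<sigma>' \<notin> S) :: real"
  have pairs: "real i + 1 \<le> (\<Sum>\<sigma>\<in>facets i \<tau>. \<Sum>\<sigma>'\<in>facets i \<tau> - {\<sigma>}. ?F \<sigma> \<sigma>')"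
    if "\<tau> \<in> expanding_faces X i S" for \<tau>
  proof -
    define A where "A = facets i \<tau> \<inter> S"
    define B where "B = facets i \<tau> - S"
    have \<tau>: "\<tau> \<in> faces X (i + 1)" using that by (simp add: expanding_faces_def)
    have fin: "finite A" "finite B" using finite_facets by (auto simp: A_def B_def)
    have "A \<noteq> {}" "B \<noteq> {}"
      using that S by (auto simp: expanding_faces_def A_def B_def facets_def)
    then have "card A \<ge> 1" "card B \<ge> 1" using fin by (simp_all add: Suc_le_eq card_gt_0_iff)
    moreover have "card A + card B = i + 2"
    proof -
      have "card (A \<union> B) = card A + card B"
        using fin by (intro card_Un_disjoint) (auto simp: A_def B_def)
      moreover have "A \<union> B = facets i \<tau>" by (auto simp: A_def B_def)
      ultimately show ?thesis using card_facets[OF \<tau>] by simp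
    qed
    ultimately have "real i + 1 \<le> real (card A) * real (card B)"
    proof -
      assume a: "1 \<le> card A" "1 \<le> card B" "card A + card B = i + 2"
      then have "0 \<le> (real (card A) - 1) * (real (card B) - 1)" by simp
      moreover have "real (card A) + real (card B) = real i + 2" using a(3) by linarith
      ultimately show ?thesis by (simp add: algebra_simps)
    qed
    also have "\<dots> = (\<Sum>\<sigma>\<in>A. \<Sum>\<sigma>'\<in>B. ?F \<sigma> \<sigma>')"
      by (simp add: A_def B_def)
    also have "\<dots> = (\<Sum>\<sigma>\<in>A. \<Sum>\<sigma>'\<in>facets i \<tau> - {\<sigma>}. ?F \<sigma> \<sigma>')"
      using finite_facets by (intro sum.cong refl sum.mono_neutral_left) (auto simp: A_def B_def)
    also have "\<dots> \<le> (\<Sum>\<sigma>\<in>facets i \<tau>. \<Sum>\<sigma>'\<in>facets i \<tau> - {\<sigma>}. ?F \<sigma> \<sigma>')"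
      using finite_facets by (intro sum_mono2 sum_nonneg) (auto simp: A_def)
    finally show ?thesis .
  qed
  have "(real i + 1) * (\<Sum>\<tau>\<in>expanding_faces X i S. deg \<tau>)
      \<le> (\<Sum>\<tau>\<in>expanding_faces X i S. deg \<tau> * (\<Sum>\<sigma>\<in>facets i \<tau>. \<Sum>\<sigma>'\<in>facets i \<tau> - {\<sigma>}. ?F \<sigma> \<sigma>'))"
    unfolding mult.commute[of "real i + 1"] sum_distrib_right[of _ _ "real i + 1"]
    by (intro sum_mono mult_left_mono pairs) auto
  also have "\<dots> \<le> (\<Sum>\<tau>\<in>faces X (i + 1). deg \<tau> * (\<Sum>\<sigma>\<in>facets i \<tau>. \<Sum>\<sigma>'\<in>facets i \<tau> - {\<sigma>}. ?F \<sigma> \<sigma>'))"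
    using finite_faces
    by (intro sum_mono2 mult_nonneg_nonneg sum_nonneg) (auto simp: expanding_faces_def)
  also have "\<dots> = (\<Sum>\<sigma>\<in>faces X i. \<Sum>\<sigma>'\<in>faces X i. real (nonlazy_edges d X i \<sigma> \<sigma>') * ?F \<sigma> \<sigma>')"
    by (rule sum_nonlazy_edges[symmetric])
  also have "\<dots> = (\<Sum>\<sigma>\<in>S. \<Sum>\<sigma>'\<in>faces X i. real (nonlazy_edges d X i \<sigma> \<sigma>') * ?F \<sigma> \<sigma>')"
    using S by (intro sum.mono_neutral_right finite_faces) auto
  also have "\<dots> = (\<Sum>\<sigma>\<in>S. \<Sum>\<sigma>'\<in>faces X i - S. real (nonlazy_edges d X i \<sigma> \<sigma>'))"
    by (intro sum.cong refl sum.mono_neutral_cong_right finite_faces) auto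
  finally show ?thesis .
qed

section \<open>Bounds from colorful expansion\<close>

lemma nonlazy_weighted_graph:
  "weighted_graph (faces X i) (\<lambda>\<sigma> \<sigma>'. real (nonlazy_edges d X i \<sigma> \<sigma>'))"
  by standard (auto simp: finite_faces nonlazy_edges_sym)

text \<open>Let \<open>a\<close> and \<open>b\<close> be the degree sums of \<open>S\<close> and its
  expanding faces. Expansion and the ratio \<open>(d - i) / (i + 2)\<close> of the total degrees
  give \<open>b \<ge> \<epsilon> * (d - i) * a / (i + 2)\<close>. The cut weighs at least
  \<open>(i + 1) * b\<close> and the volume is \<open>(i + 1) * (d - i) * a\<close>, so the factors
  \<open>(i + 1) * (d - i)\<close> cancel.\<close>

lemma nonlazy_conductance:
  assumes exp: "colorful_expander d X \<epsilon>" and i: "i < d"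
  shows "weighted_graph.conductance_ge (faces X i) (\<lambda>\<sigma> \<sigma>'. real (nonlazy_edges d X i \<sigma> \<sigma>'))
     (\<epsilon> / (real i + 2))"
proof -
  interpret G: weighted_graph "faces X i" "\<lambda>\<sigma> \<sigma>'. real (nonlazy_edges d X i \<sigma> \<sigma>')"
    by (rule nonlazy_weighted_graph)
  define K where "K = (real i + 1) * real (d - i)"
  have K: "0 < K" using i by (simp add: K_def)
  have vol: "sum G.wdeg S = K * sum deg S" if "S \<subseteq> faces X i" for S
    using that by (auto simp: sum_distrib_left G.wdeg_def nonlazy_degree K_def intro!: sum.cong)
  have "\<epsilon> / (real i + 2) * sum G.wdeg S
      \<le> (\<Sum>\<sigma>\<in>S. \<Sum>\<sigma>'\<in>faces X i - S. real (nonlazy_edges d X i \<sigma> \<sigma>'))"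
    if S: "S \<subseteq> faces X i" and half: "sum G.wdeg S \<le> sum G.wdeg (faces X i) / 2" for S
  proof (cases "sum deg S = 0")
    \<comment> \<open>Expansion speaks only of positive norms; at zero volume the bound is
      trivial.\<close>
    case True
    then show ?thesis by (simp add: vol[OF S] sum_nonneg)
  next
    case False
    define a where "a = sum deg S"
    define T where "T = sum deg (faces X i)"
    define T' where "T' = sum deg (faces X (i + 1))"
    define b where "b = sum deg (expanding_faces X i S)"
    have a: "0 < a" using False by (simp add: a_def order_less_le sum_nonneg)
    have T: "0 < T" unfolding T_def
      using i by (intro sum_pos finite_faces faces_nonempty deg_pos) auto
    have T'_eq: "(real i + 2) * T' = real (d - i) * T"
      unfolding T_def T'_def by (rule total_deg_step)
    have "K * a \<le> K * T / 2" using half by (simp add: vol S a_def T_def)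
    then have "a \<le> T / 2" using K by simp
    then have "0 < cochain_norm d X i S" "cochain_norm d X i S \<le> 1 / 2"
      using a T by (simp_all add: cochain_norm_def a_def T_def field_simps)
    then have "\<epsilon> \<le> cochain_norm d X (i + 1) (expanding_faces X i S) / cochain_norm d X i S"
      using exp i S by (simp add: colorful_expander_def)
    then have "\<epsilon> \<le> (b / T') / (a / T)"
      by (simp add: cochain_norm_def a_def T_def T'_def b_def)
    also have "\<dots> = b * T / (T' * a)" by simp
    also have "T' = real (d - i) * T / (real i + 2)" using T'_eq by (simp add: field_simps)
    finally have "\<epsilon> \<le> b * (real i + 2) / (real (d - i) * a)" using T by (simp add: mult_ac)
    then have "\<epsilon> * (real (d - i) * a) \<le> b * (real i + 2)"
      using a i by (simp add: pos_le_divide_eq)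
    then have "\<epsilon> / (real i + 2) * (real (d - i) * a) \<le> b"
      by (simp add: field_simps)
    then have "(real i + 1) * (\<epsilon> / (real i + 2) * (real (d - i) * a)) \<le> (real i + 1) * b"
      by (intro mult_left_mono) auto
    moreover have "\<epsilon> / (real i + 2) * sum G.wdeg S
        = (real i + 1) * (\<epsilon> / (real i + 2) * (real (d - i) * a))"
      by (simp add: vol[OF S] K_def a_def)
    ultimately show ?thesis using nonlazy_cut_ge[OF S] unfolding b_def by linarith
  qed
  then show ?thesis by (simp add: G.conductance_ge_def)
qed

text \<open>Cheeger's inequality for the conductance just found. Graph degrees are a constant
  multiple of \<open>deg\<close>, so both weights give the same orthogonality condition.\<close>

lemma nonlazy_form_le:
  assumes exp: "colorful_expander d X \<epsilon>" and i: "i < d"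
    and orth: "(\<Sum>\<sigma>\<in>faces X i. deg \<sigma> * f \<sigma>) = 0"
  shows "(\<Sum>\<sigma>\<in>faces X i. \<Sum>\<sigma>'\<in>faces X i. real (nonlazy_edges d X i \<sigma> \<sigma>') * (f \<sigma> * f \<sigma>'))
     \<le> (1 - (\<epsilon> / (real i + 2))\<^sup>2 / 2) * ((real i + 1) * real (d - i) * (\<Sum>\<sigma>\<in>faces X i. deg \<sigma> * (f \<sigma>)\<^sup>2))"
proof -
  interpret G: weighted_graph "faces X i" "\<lambda>\<sigma> \<sigma>'. real (nonlazy_edges d X i \<sigma> \<sigma>')"
    by (rule nonlazy_weighted_graph)
  have wsum: "(\<Sum>\<sigma>\<in>faces X i. G.wdeg \<sigma> * g \<sigma>)
      = (real i + 1) * real (d - i) * (\<Sum>\<sigma>\<in>faces X i. deg \<sigma> * g \<sigma>)" for g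
    by (simp add: G.wdeg_def nonlazy_degree sum_distrib_left mult.assoc)
  have "0 \<le> \<epsilon>" using exp by (simp add: colorful_expander_def)
  then have "G.qform f f \<le> (1 - (\<epsilon> / (real i + 2))\<^sup>2 / 2) * G.sqnorm f"
    using orth by (intro G.qform_le_of_conductance nonlazy_conductance[OF exp i]) (simp_all add: wsum)
  then show ?thesis by (simp only: G.qform_def G.sqnorm_def wsum)
qed

text \<open>The lighter of two vertices has norm at most \<open>1/2\<close>, and its expanding faces have norm at most
  twice that.\<close>

lemma colorful_expander_le_2:
  assumes exp: "colorful_expander d X \<epsilon>" and d: "0 < d"
  shows "\<epsilon> \<le> 2"
proof -
  define T where "T = sum deg (faces X 0)"
  define T' where "T' = sum deg (faces X 1)"
  obtain \<tau> where \<tau>: "\<tau> \<in> faces X (0 + 1)" using faces_nonempty[of 1] d by auto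
  then have "card (facets 0 \<tau>) = 2" by (simp add: card_facets)
  then obtain u v where uv: "facets 0 \<tau> = {u, v}" "u \<noteq> v" by (auto simp: card_2_iff)
  have "u \<in> faces X 0" "v \<in> faces X 0" using uv(1) by (auto simp: facets_def)
  then obtain x where x: "x \<in> faces X 0" "2 * deg x \<le> T"
  proof -
    assume u: "u \<in> faces X 0" and v: "v \<in> faces X 0"
    assume *: "\<And>x. \<lbrakk>x \<in> faces X 0; 2 * deg x \<le> T\<rbrakk> \<Longrightarrow> thesis"
    have "deg u + deg v = sum deg {u, v}" using uv by simp
    also have "\<dots> \<le> T" unfolding T_def using u v by (intro sum_mono2 finite_faces) auto
    finally have "deg u + deg v \<le> T" .
    then have "2 * deg u \<le> T \<or> 2 * deg v \<le> T" by linarith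
    then show thesis using * u v by blast
  qed
  have a: "0 < deg x" by (rule deg_pos[OF x(1)])
  then have T: "0 < T" using x(2) by linarith
  have T': "2 * T' = real d * T"
    using total_deg_step[of 0] by (simp add: T_def T'_def)
  have "0 < cochain_norm d X 0 {x}" "cochain_norm d X 0 {x} \<le> 1 / 2"
    using a T x(2) by (simp_all add: cochain_norm_def T_def[symmetric] field_simps)
  then have "\<epsilon> \<le> cochain_norm d X 1 (expanding_faces X 0 {x}) / cochain_norm d X 0 {x}"
    using exp d x(1) by (auto simp: colorful_expander_def)
  also have "\<dots> = sum deg (expanding_faces X 0 {x}) / T' / (deg x / T)"
    by (simp add: cochain_norm_def T_def T'_def)
  \<comment> \<open>Every expanding edge of \<open>{x}\<close> contains \<open>x\<close>, and the
    degrees of the edges at \<open>x\<close> sum to \<open>d * deg x\<close>.\<close>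
  also have "\<dots> \<le> real d * deg x / T' / (deg x / T)"
  proof -
    have "sum deg (expanding_faces X 0 {x}) \<le> (\<Sum>\<tau> | \<tau> \<in> faces X (0 + 1) \<and> x \<subset> \<tau>. deg \<tau>)"
      using finite_faces by (intro sum_mono2) (auto simp: expanding_faces_def)
    also have "\<dots> = real d * deg x" using sum_deg_cofaces[OF x(1)] by simp
    finally have "sum deg (expanding_faces X 0 {x}) \<le> real d * deg x" .
    moreover have "0 \<le> T'" unfolding T'_def by (intro sum_nonneg) auto
    ultimately show ?thesis using T a by (intro divide_right_mono) auto
  qed
  also have "\<dots> = real d * T / T'" using a by simp
  also have "\<dots> = 2"
  proof -
    have "0 < T'" using T' T d by (metis mult_pos_pos of_nat_0_less_iff zero_less_mult_pos zero_less_numeral)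
    then show ?thesis using T' by (simp add: field_simps)
  qed
  finally show ?thesis .
qed

section \<open>Mixing of the high order walks\<close>

lemma rapidly_mixing_higher:
  assumes exp: "colorful_expander d X \<epsilon>" and i: "0 < i" "i < d"
    and \<mu>: "1 / 2 \<le> \<mu>" "\<mu> < 1" "1 - (\<epsilon> / (real i + 2))\<^sup>2 / 2 \<le> \<mu>"
  shows "rapidly_mixing (faces X i) (high_order_edges d X i) \<mu>"
proof -
  have edges: "high_order_edges d X i = nonlazy_edges d X i"
    using i by (simp add: high_order_edges_def fun_eq_iff)
  have D: "real (graph_deg (faces X i) (nonlazy_edges d X i) \<sigma>) = (real i + 1) * real (d - i) * deg \<sigma>"
    if "\<sigma> \<in> faces X i" for \<sigma>
    using nonlazy_degree[OF that] by (simp add: graph_deg_def)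
  have pos: "0 < real (graph_deg (faces X i) (nonlazy_edges d X i) \<sigma>)" if "\<sigma> \<in> faces X i" for \<sigma>
    unfolding D[OF that] using i deg_pos[OF that] by (intro mult_pos_pos) auto
  have wsum: "(\<Sum>\<sigma>\<in>faces X i. real (graph_deg (faces X i) (nonlazy_edges d X i) \<sigma>) * g \<sigma>)
      = (real i + 1) * real (d - i) * (\<Sum>\<sigma>\<in>faces X i. deg \<sigma> * g \<sigma>)" for g
    by (simp add: D sum_distrib_left mult.assoc)
  show ?thesis
    unfolding edges
  proof (rule rapidly_mixing_of_qform_bound)
    fix f
    assume "(\<Sum>\<sigma>\<in>faces X i. real (graph_deg (faces X i) (nonlazy_edges d X i) \<sigma>) * f \<sigma>) = 0"
    then have orth: "(\<Sum>\<sigma>\<in>faces X i. deg \<sigma> * f \<sigma>) = 0" using i by (simp add: wsum)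
    define Q where "Q = (\<Sum>\<sigma>\<in>faces X i. deg \<sigma> * (f \<sigma>)\<^sup>2)"
    define R where "R = (\<Sum>\<sigma>\<in>faces X i. \<Sum>\<sigma>'\<in>faces X i. real (nonlazy_edges d X i \<sigma> \<sigma>') * (f \<sigma> * f \<sigma>'))"
    have Q: "0 \<le> real (d - i) * Q" by (simp add: Q_def sum_nonneg)
    have "R \<le> (1 - (\<epsilon> / (real i + 2))\<^sup>2 / 2) * ((real i + 1) * real (d - i) * Q)"
      using nonlazy_form_le[OF exp i(2) orth] by (simp add: R_def Q_def)
    also have "\<dots> \<le> \<mu> * ((real i + 1) * real (d - i) * Q)"
      using Q by (intro mult_right_mono \<mu>) (simp add: mult.assoc)
    finally have upper: "R \<le> \<mu> * ((real i + 1) * real (d - i) * Q)" .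
    \<comment> \<open>With \<open>\<mu> \<ge> 1 / 2\<close> and \<open>i + 1 \<ge> 2\<close>, the
      lower bound \<open>- 1 / (i + 1)\<close> on the normalized form is at least
      \<open>- \<mu>\<close>.\<close>
    have "1 \<le> \<mu> * (real i + 1)"
      using mult_mono[of "1 / 2" \<mu> 2 "real i + 1"] \<mu>(1) i(1) by simp
    then have "1 * (real (d - i) * Q) \<le> \<mu> * (real i + 1) * (real (d - i) * Q)"
      using Q by (intro mult_right_mono)
    then have "- (\<mu> * ((real i + 1) * real (d - i) * Q)) \<le> R"
      using nonlazy_form_ge[of i f] by (simp add: R_def Q_def mult.assoc)
    with upper have "\<bar>R\<bar> \<le> \<mu> * ((real i + 1) * real (d - i) * Q)" by (simp add: abs_le_iff)
    then show "\<bar>\<Sum>\<sigma>\<in>faces X i. \<Sum>\<sigma>'\<in>faces X i. real (nonlazy_edges d X i \<sigma> \<sigma>') * (f \<sigma> * f \<sigma>')\<bar>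
        \<le> \<mu> * (\<Sum>\<sigma>\<in>faces X i. real (graph_deg (faces X i) (nonlazy_edges d X i) \<sigma>) * (f \<sigma>)\<^sup>2)"
      by (simp only: R_def Q_def wsum)
  qed (use i \<mu> finite_faces faces_nonempty[of i] pos in \<open>auto simp: nonlazy_edges_sym\<close>)
qed

text \<open>The loops double each degree and replace a normalized form \<open>r\<close> by
  \<open>(1 + r) / 2\<close>. Cheeger's bound \<open>1 - \<epsilon>\<^sup>2 / 8\<close> therefore
  becomes \<open>1 - \<epsilon>\<^sup>2 / 16\<close>.\<close>

lemma rapidly_mixing_vertices:
  assumes exp: "colorful_expander d X \<epsilon>" and d: "0 < d"
    and \<mu>: "0 < \<mu>" "\<mu> < 1" "1 - \<epsilon>\<^sup>2 / 16 \<le> \<mu>"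
  shows "rapidly_mixing (faces X 0) (high_order_edges d X 0) \<mu>"
proof -
  \<comment> \<open>The union of a vertex with itself is too small to be an edge, so the loops added
    for laziness replace nothing.\<close>
  have loop: "nonlazy_edges d X 0 \<sigma> \<sigma> = 0" for \<sigma>
    by (auto simp: nonlazy_edges_def face_neighbors_def faces_def)
  have base: "real (graph_deg (faces X 0) (nonlazy_edges d X 0) \<sigma>) = real d * deg \<sigma>"
    if "\<sigma> \<in> faces X 0" for \<sigma>
    using nonlazy_degree[OF that] by (simp add: graph_deg_def)
  have edges: "real (high_order_edges d X 0 \<sigma> \<sigma>')
      = real (nonlazy_edges d X 0 \<sigma> \<sigma>') + (if \<sigma>' = \<sigma> then real d * deg \<sigma> else 0)"
    if "\<sigma> \<in> faces X 0" for \<sigma> \<sigma>'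
    using base[OF that] by (simp add: high_order_edges_def loop)
  have D: "real (graph_deg (faces X 0) (high_order_edges d X 0) \<sigma>) = 2 * real d * deg \<sigma>"
    if "\<sigma> \<in> faces X 0" for \<sigma>
    using nonlazy_degree[OF that] that
    by (simp add: graph_deg_def edges sum.distrib sum.delta finite_faces)
  have pos: "0 < real (graph_deg (faces X 0) (high_order_edges d X 0) \<sigma>)" if "\<sigma> \<in> faces X 0" for \<sigma>
    unfolding D[OF that] using d deg_pos[OF that] by (intro mult_pos_pos) auto
  have wsum: "(\<Sum>\<sigma>\<in>faces X 0. real (graph_deg (faces X 0) (high_order_edges d X 0) \<sigma>) * g \<sigma>)
      = 2 * real d * (\<Sum>\<sigma>\<in>faces X 0. deg \<sigma> * g \<sigma>)" for g
    by (simp add: D sum_distrib_left mult.assoc)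
  show ?thesis
  proof (rule rapidly_mixing_of_qform_bound)
    fix f
    assume "(\<Sum>\<sigma>\<in>faces X 0. real (graph_deg (faces X 0) (high_order_edges d X 0) \<sigma>) * f \<sigma>) = 0"
    then have orth: "(\<Sum>\<sigma>\<in>faces X 0. deg \<sigma> * f \<sigma>) = 0" using d by (simp add: wsum)
    define Q where "Q = (\<Sum>\<sigma>\<in>faces X 0. deg \<sigma> * (f \<sigma>)\<^sup>2)"
    define R where "R = (\<Sum>\<sigma>\<in>faces X 0. \<Sum>\<sigma>'\<in>faces X 0. real (nonlazy_edges d X 0 \<sigma> \<sigma>') * (f \<sigma> * f \<sigma>'))"
    define L where "L = (\<Sum>\<sigma>\<in>faces X 0. \<Sum>\<sigma>'\<in>faces X 0. real (high_order_edges d X 0 \<sigma> \<sigma>') * (f \<sigma> * f \<sigma>'))"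
    have Q: "0 \<le> real d * Q" by (simp add: Q_def sum_nonneg)
    have L: "L = R + real d * Q"
    proof -
      have "L = (\<Sum>\<sigma>\<in>faces X 0. (\<Sum>\<sigma>'\<in>faces X 0. real (nonlazy_edges d X 0 \<sigma> \<sigma>') * (f \<sigma> * f \<sigma>'))
          + (\<Sum>\<sigma>'\<in>faces X 0. if \<sigma>' = \<sigma> then real d * (deg \<sigma> * (f \<sigma>)\<^sup>2) else 0))"
        unfolding L_def sum.distrib[symmetric]
        by (intro sum.cong refl) (simp add: edges power2_eq_square algebra_simps)
      then show ?thesis
        by (simp add: sum.distrib sum.delta finite_faces R_def Q_def sum_distrib_left)
    qed
    have "R \<le> (1 - (\<epsilon> / 2)\<^sup>2 / 2) * (real d * Q)"
      using nonlazy_form_le[OF exp d orth] by (simp add: R_def Q_def)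
    then have "L \<le> (1 - \<epsilon>\<^sup>2 / 16) * (2 * real d * Q)"
      by (simp add: L power_divide algebra_simps)
    also have "\<dots> \<le> \<mu> * (2 * real d * Q)" using Q by (intro mult_right_mono \<mu>) (simp add: mult.assoc)
    finally have upper: "L \<le> \<mu> * (2 * real d * Q)" .
    \<comment> \<open>The nonlazy form is at least \<open>- real d * Q\<close>, which is exactly
      compensated by the loops.\<close>
    have "0 \<le> L" using nonlazy_form_ge[of 0 f] by (simp add: L R_def Q_def)
    with upper show "\<bar>\<Sum>\<sigma>\<in>faces X 0. \<Sum>\<sigma>'\<in>faces X 0. real (high_order_edges d X 0 \<sigma> \<sigma>') * (f \<sigma> * f \<sigma>')\<bar>
        \<le> \<mu> * (\<Sum>\<sigma>\<in>faces X 0. real (graph_deg (faces X 0) (high_order_edges d X 0) \<sigma>) * (f \<sigma>)\<^sup>2)"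
      by (simp add: L_def Q_def wsum)
  qed (use \<mu> finite_faces faces_nonempty[of 0] pos in
      \<open>auto simp: nonlazy_edges_sym high_order_edges_def\<close>)
qed

end

theorem theorem3p1:
  fixes X :: "'a set set" and d :: nat and \<epsilon> :: real
  assumes "pure_simplicial_complex d X"
    and "d > 1"
    and "colorful_expander d X \<epsilon>"
  shows "\<forall>i<d. rapidly_mixing (faces X i) (high_order_edges d X i)
           (1 - \<epsilon>\<^sup>2 / (2 * (real d + 1)\<^sup>2))"
proof (intro allI impI)
  fix i assume i: "i < d"
  interpret pure_complex d X by standard (rule assms(1))
  define \<mu> where "\<mu> = 1 - \<epsilon>\<^sup>2 / (2 * (real d + 1)\<^sup>2)"
  have pos: "0 < \<epsilon>" using assms(3) by (simp add: colorful_expander_def)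
  have "\<epsilon> \<le> 2" using colorful_expander_le_2[OF assms(3)] assms(2) by simp
  then have sq: "\<epsilon>\<^sup>2 \<le> 4" using pos power_mono[of \<epsilon> 2 2] by simp
  have d: "9 \<le> (real d + 1)\<^sup>2" using assms(2) power_mono[of 3 "real d + 1" 2] by simp
  have "\<epsilon>\<^sup>2 / (2 * (real d + 1)\<^sup>2) \<le> 4 / (2 * 9)"
    using sq d by (intro frac_le) auto
  then have half: "1 / 2 \<le> \<mu>" unfolding \<mu>_def by linarith
  have less1: "\<mu> < 1" using pos d by (simp add: \<mu>_def)
  show "rapidly_mixing (faces X i) (high_order_edges d X i) (1 - \<epsilon>\<^sup>2 / (2 * (real d + 1)\<^sup>2))"
  proof (cases "i = 0")
    case True
    \<comment> \<open>\<open>d > 1\<close> enters here through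
      \<open>2 * (d + 1)\<^sup>2 \<ge> 18 \<ge> 16\<close>; for \<open>d = 1\<close> the left side
      of this chain would be 8.\<close>
    have "\<epsilon>\<^sup>2 / (2 * (real d + 1)\<^sup>2) \<le> \<epsilon>\<^sup>2 / 16" using d by (intro divide_left_mono) auto
    then have "1 - \<epsilon>\<^sup>2 / 16 \<le> \<mu>" by (simp add: \<mu>_def)
    then show ?thesis
      using rapidly_mixing_vertices[OF assms(3)] True half less1 i unfolding \<mu>_def by simp
  next
    case False
    \<comment> \<open>From \<open>i < d\<close> follows \<open>i + 2 \<le> d + 1\<close>, so the top
      dimension \<open>i = d - 1\<close> determines the uniform constant.\<close>
    have "(real i + 2)\<^sup>2 \<le> (real d + 1)\<^sup>2" using i by (intro power_mono) auto
    then have "\<epsilon>\<^sup>2 / (2 * (real d + 1)\<^sup>2) \<le> \<epsilon>\<^sup>2 / (2 * (real i + 2)\<^sup>2)"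
      by (intro divide_left_mono) auto
    then have "1 - (\<epsilon> / (real i + 2))\<^sup>2 / 2 \<le> \<mu>"
      by (simp add: \<mu>_def power_divide mult.commute)
    then show ?thesis
      using rapidly_mixing_higher[OF assms(3) _ i] False half less1 unfolding \<mu>_def by simp
  qed
qed

end
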